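(* Let $\zeta(j,x)$ and $\theta(j,x)$ be uncorrelated random fields of the type described in the context, with spectral density matrices $F_m(\lambda)$ and $G_m(\lambda)$ of their generating sequences satisfying the minimality condition $M(F+G)\neq\emptyset$. Then the spectral characteristic $h(F,G)=\{h_m^l(F,G)\}$ of the optimal linear estimate of $A_N\zeta$ based on observations of $\zeta(j,x)+\theta(j,x)$ at the points $(j,x)$, $j\in\mathbb Z\setminus\{0,1,\dots,N\}$, $x\in S_n$, is given by \[h_m^l(F,G)^\top=r_F^N(\lambda)(H_m(\lambda))^{-1}=A_{mN}^l(\lambda)^\top-r_G^N(\lambda)(H_m(\lambda))^{-1},\] and the mean-square error of this estimate is \[\Delta(h(F,G);F,G)=\sum_{m\in M}\sum_{l=1}^{h(m,n)}\frac1{2\pi}\int_{-\pi}^{\pi}\Big[r_G^N(\lambda)H_m^{-1}(\lambda)F_m(\lambda)H_m^{-1}(\lambda)(r_G^N(\lambda))^*+r_F^N(\lambda)H_m^{-1}(\lambda)G_m(\lambda)H_m^{-1}(\lambda)(r_F^N(\lambda))^*\Big]d\lambda\] \[=\sum_{m\in M}\sum_{l=1}^{h(m,n)}\Big(\langle\mathbf c_{mN}^l,\mathbf B_{mN}\mathbf c_{mN}^l\rangle+\langle\mathbf a_{mN}^l,\mathbf R_{mN}\mathbf a_{mN}^l\rangle\Big),\] where $\mathbf c_{mN}^l=\mathbf B_{mN}^{-1}\mathbf D_{mN}\mathbf a_{mN}^l$.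
   Context: Let $S_n$ be the unit sphere in the Euclidean space $\mathbb E^n$, $m_n(dx)$ the Lebesgue measure on $S_n$, and $S_m^l(x)$, $l=1,\dots,h(m,n)$, $m=0,1,\dots$, the orthonormal spherical harmonics of degree $m$. Fix integers $T\ge1$ (period) and $N\ge0$. The field $\zeta(j,x)$, $j\in\mathbb Z$, $x\in S_n$, has zero mean and finite second moments, is periodically correlated with period $T$ in $j$ and mean-square continuous and isotropic on $S_n$ in $x$. It expands as $\zeta(j,x)=\sum_{m=0}^\infty\sum_{l=1}^{h(m,n)}S_m^l(x)\zeta_m^l(j)$, $\zeta_m^l(j)=\int_{S_n}\zeta(j,x)S_m^l(x)m_n(dx)$, where the $\zeta_m^l$ are mutually uncorrelated periodically correlated (period $T$) sequences with correlation functions depending only on $m$, and $\zeta_m^l(j)=\sum_{k=0}^{T-1}e^{2\pi ijk/T}\xi_{mk}^l(j)$ with $\vec\xi_m^l(j)=(\xi_{m0}^l(j),\dots,\xi_{m,T-1}^l(j))^\top$ a $T$-variate stationary sequence (generating sequence) with spectral stochastic measure $(Z_{\vec\xi})_m^l(d\lambda)$ and $T\times T$ spectral density matrix $F_m(\lambda)$, $\lambda\in[-\pi,\pi]$. The field $\theta(j,x)$ is of the same type, uncorrelated with $\zeta$, with coefficients $\theta_m^l(j)=\sum_{k=0}^{T-1}e^{2\pi ijk/T}\eta_{mk}^l(j)$, generating sequences $\vec\eta_m^l$ with spectral measures $(Z_{\vec\eta})_m^l$ and spectral density matrices $G_m(\lambda)$. Put $F=\{F_m\}$, $G=\{G_m\}$,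 $H_m=F_m+G_m$, and let $M=M(F+G)$ be the set of $m$ with $\int_{-\pi}^{\pi}\mathrm{Tr}[(F_m(\lambda)+G_m(\lambda))^{-1}]d\lambda<\infty$. Functional: for a given function $a(j,x)$, $A_N\zeta=\sum_{j=0}^N\int_{S_n}a(j,x)\zeta(j,x)m_n(dx)=\sum_{m}\sum_{l}\sum_{j=0}^N(\vec a_m^l(j))^\top\vec\xi_m^l(j)$, where $\vec a_m^l(j)=(a_{m0}^l(j),\dots,a_{m,T-1}^l(j))^\top$, $a_{mk}^l(j)=a_m^l(j)e^{2\pi ikj/T}$, and $a_m^l(j)$ are the spherical-harmonic coefficients of $a(j,\cdot)$. Put $A_{mN}^l(\lambda)=\sum_{j=0}^N\vec a_m^l(j)e^{ij\lambda}$ and $\mathbf a_{mN}^l=(\vec a_m^l(0),\dots,\vec a_m^l(N))$. Estimates: a linear estimate based on observations of $\zeta(j,x)+\theta(j,x)$, $j\in\mathbb Z\setminus\{0,\dots,N\}$, $x\in S_n$, has the form $\widehat{A_N\zeta}=\sum_{m\in M}\sum_{l}\int_{-\pi}^{\pi}h_m^l(\lambda)^\top\big((Z_{\vec\xi})_m^l(d\lambda)+(Z_{\vec\eta})_m^l(d\lambda)\big)$ where the spectral characteristic $h=\{h_m^l\}$ lies in the space $L_2^{N-}(F+G)$ generated by $\mathbb C^T$-valued functions $h_m^l(\lambda)=\sum_{j\in\mathbb Z\setminus\{0,\dots,N\}}\vec h_m^l(j)e^{ij\lambda}$ with $\sum_m\sum_l\int_{-\pi}^{\pi}h_m^l(\lambda)^\top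 H_m(\lambda)\overline{h_m^l(\lambda)}d\lambda<\infty$. Its mean-square error is $\Delta(h;F,G)=\mathbb E|A_N\zeta-\widehat{A_N\zeta}|^2=\sum_{m\in M}\sum_l\frac1{2\pi}\int_{-\pi}^{\pi}(A_{mN}^l-h_m^l)^\top F_m\overline{(A_{mN}^l-h_m^l)}d\lambda+\sum_{m\in M}\sum_l\frac1{2\pi}\int_{-\pi}^{\pi}(h_m^l)^\top G_m\overline{h_m^l}d\lambda$. The optimal estimate has spectral characteristic $h(F,G)$ minimizing $\Delta(h;F,G)$. Operators: $\mathbf B_{mN},\mathbf D_{mN},\mathbf R_{mN}$ are given by the block matrices $\{B_m(k,j)\}_{k,j=0}^N$, $\{D_m(k,j)\}$, $\{R_m(k,j)\}$ with $T\times T$ blocks $B_m(k,j)=\frac1{2\pi}\int_{-\pi}^{\pi}[H_m(\lambda)^{-1}]^\top e^{i(j-k)\lambda}d\lambda$, $D_m(k,j)=\frac1{2\pi}\int_{-\pi}^{\pi}[F_m(\lambda)H_m(\lambda)^{-1}]^\top e^{i(j-k)\lambda}d\lambda$, $R_m(k,j)=\frac1{2\pi}\int_{-\pi}^{\pi}[F_m(\lambda)H_m(\lambda)^{-1}G_m(\lambda)]^\top e^{i(j-k)\lambda}d\lambda$, $k,j=0,\dots,N$. With $\mathbf c_{mN}^l=(\vec c_m^l(0),\dots,\vec c_m^l(N))$ put $C_{mN}^l(\lambda)=\sum_{j=0}^N\vec c_m^l(j)e^{ij\lambda}$, $r_F^N(\lambda)=A_{mN}^l(\lambda)^\top F_m(\lambda)-C_{mN}^l(\lambda)^\top$,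 $r_G^N(\lambda)=A_{mN}^l(\lambda)^\top G_m(\lambda)+C_{mN}^l(\lambda)^\top$ (dependence on $m,l$ suppressed). *)

theory Defs
  imports "HOL-Analysis.Analysis" "Jordan_Normal_Form.Gauss_Jordan_Elimination"
begin

definition intpi :: "(real \<Rightarrow> complex) \<Rightarrow> complex" where
  "intpi f = interval_lebesgue_integral lborel (ereal (-pi)) (ereal pi) f"

definition intblepi :: "(real \<Rightarrow> complex) \<Rightarrow> bool" where
  "intblepi f = interval_lebesgue_integrable lborel (ereal (-pi)) (ereal pi) f"

definition minv :: "complex mat \<Rightarrow> complex mat" where
  "minv A = (case mat_inverse A of Some B \<Rightarrow> B | None \<Rightarrow> 0\<^sub>m (dim_row A) (dim_col A))"

definition mtrace :: "complex mat \<Rightarrow> complex" where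
  "mtrace A = (\<Sum>i<dim_row A. A $$ (i,i))"

definition cvec :: "complex vec \<Rightarrow> complex vec" where
  "cvec v = map_vec cnj v"

text \<open>qform r M s = r^T M conj(s)  (r, s column vectors standing for rows).\<close>
definition qform :: "complex vec \<Rightarrow> complex mat \<Rightarrow> complex vec \<Rightarrow> complex" where
  "qform r M s = scalar_prod r (mult_mat_vec M (cvec s))"

text \<open>Number h(m,n) of orthonormal spherical harmonics of degree m on S_n (n >= 2).\<close>
definition hdim :: "nat \<Rightarrow> nat \<Rightarrow> nat" where
  "hdim m n = ((m + n - 1) choose (n - 1)) - ((m + n - 3) choose (n - 1))"

definition spectral_density :: "nat \<Rightarrow> (real \<Rightarrow> complex mat) \<Rightarrow> bool" where
  "spectral_density T F \<longleftrightarrow>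
     (\<forall>x. F x \<in> carrier_mat T T) \<and>
     (\<forall>x\<in>{-pi..pi}. (\<forall>p<T. \<forall>q<T. F x $$ (p,q) = cnj (F x $$ (q,p))) \<and>
        (\<forall>v\<in>carrier_vec T. 0 \<le> Re (qform (cvec v) (F x) (cvec v)))) \<and>
     (\<forall>p<T. \<forall>q<T. intblepi (\<lambda>x. F x $$ (p,q)))"

definition Hmat :: "(nat \<Rightarrow> real \<Rightarrow> complex mat) \<Rightarrow> (nat \<Rightarrow> real \<Rightarrow> complex mat)
    \<Rightarrow> nat \<Rightarrow> real \<Rightarrow> complex mat" where
  "Hmat F G m x = F m x + G m x"

definition Hinv :: "(nat \<Rightarrow> real \<Rightarrow> complex mat) \<Rightarrow> (nat \<Rightarrow> real \<Rightarrow> complex mat)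
    \<Rightarrow> nat \<Rightarrow> real \<Rightarrow> complex mat" where
  "Hinv F G m x = minv (Hmat F G m x)"

definition Mset :: "(nat \<Rightarrow> real \<Rightarrow> complex mat) \<Rightarrow> (nat \<Rightarrow> real \<Rightarrow> complex mat) \<Rightarrow> nat set" where
  "Mset F G = {m. (AE x in lborel. x \<in> {-pi..pi} \<longrightarrow> mat_inverse (Hmat F G m x) \<noteq> None)
                  \<and> intblepi (\<lambda>x. mtrace (Hinv F G m x))}"

definition evec :: "nat \<Rightarrow> nat \<Rightarrow> complex vec" where
  "evec T j = vec T (\<lambda>k. exp (2 * pi * \<i> * of_nat k * of_nat j / of_nat T))"

text \<open>a : m l j gives the spherical-harmonic coefficient a_m^l(j) of a(j,.).
  A_{mN}^l(lambda) = sum_{j=0}^N vec a_m^l(j) e^{i j lambda}.\<close>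
definition AN :: "nat \<Rightarrow> nat \<Rightarrow> (nat \<Rightarrow> nat \<Rightarrow> nat \<Rightarrow> complex) \<Rightarrow> nat \<Rightarrow> nat \<Rightarrow> real \<Rightarrow> complex vec" where
  "AN T N a m l x = vec T (\<lambda>k. \<Sum>j\<le>N. a m l j * exp (2 * pi * \<i> * of_nat k * of_nat j / of_nat T)
                                          * exp (\<i> * of_nat j * x))"

text \<open>Flattened block vector a_{mN}^l = (vec a(0),...,vec a(N)); entry j*T+k.\<close>
definition aflat :: "nat \<Rightarrow> nat \<Rightarrow> (nat \<Rightarrow> nat \<Rightarrow> nat \<Rightarrow> complex) \<Rightarrow> nat \<Rightarrow> nat \<Rightarrow> complex vec" where
  "aflat T N a m l = vec ((N+1)*T) (\<lambda>i. a m l (i div T)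
       * exp (2 * pi * \<i> * of_nat (i mod T) * of_nat (i div T) / of_nat T))"

text \<open>Block operator {Phi(k,j)}_{k,j=0..N} with blocks
  Phi(k,j) = 1/(2pi) int [Phi(lambda)]^T e^{i(j-k)lambda}; entry (k*T+p, j*T+q).\<close>
definition blockop :: "nat \<Rightarrow> nat \<Rightarrow> (real \<Rightarrow> complex mat) \<Rightarrow> complex mat" where
  "blockop T N Phi = mat ((N+1)*T) ((N+1)*T) (\<lambda>(r,s).
      1 / (2 * pi) * intpi (\<lambda>x. Phi x $$ (s mod T, r mod T)
          * exp (\<i> * (of_nat (s div T) - of_nat (r div T)) * x)))"

definition Bop where "Bop T N F G m = blockop T N (Hinv F G m)"
definition Dop where "Dop T N F G m = blockop T N (\<lambda>x. F m x * Hinv F G m x)"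
definition Rop where "Rop T N F G m = blockop T N (\<lambda>x. F m x * Hinv F G m x * G m x)"

definition cflat where
  "cflat T N F G a m l = mult_mat_vec (minv (Bop T N F G m)) (mult_mat_vec (Dop T N F G m) (aflat T N a m l))"

definition CN where
  "CN T N F G a m l x = vec T (\<lambda>p. \<Sum>j\<le>N. cflat T N F G a m l $ (j*T+p) * exp (\<i> * of_nat j * x))"

text \<open>r_F^N and r_G^N, as column vectors holding the entries of the row vectors.\<close>
definition rF where
  "rF T N F G a m l x = mult_mat_vec (transpose_mat (F m x)) (AN T N a m l x) - CN T N F G a m l x"
definition rG where
  "rG T N F G a m l x = mult_mat_vec (transpose_mat (G m x)) (AN T N a m l x) + CN T N F G a m l x"

definition L2N :: "nat \<Rightarrow> nat \<Rightarrow> nat \<Rightarrow> (nat \<Rightarrow> real \<Rightarrow> complex mat) \<Rightarrow> (nat \<Rightarrow> real \<Rightarrow> complex mat)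
    \<Rightarrow> (nat \<Rightarrow> nat \<Rightarrow> real \<Rightarrow> complex vec) set" where
  "L2N T N n F G = {h. (\<forall>m\<in>Mset F G. \<forall>l\<in>{1..hdim m n}.
        (\<forall>x. h m l x \<in> carrier_vec T) \<and>
        (\<forall>p<T. intblepi (\<lambda>x. h m l x $ p)) \<and>
        (\<forall>j\<le>N. \<forall>p<T. intpi (\<lambda>x. h m l x $ p * exp (- \<i> * of_nat j * x)) = 0) \<and>
        intblepi (\<lambda>x. qform (h m l x) (Hmat F G m x) (h m l x))) \<and>
     summable (\<lambda>m. if m \<in> Mset F G then
        (\<Sum>l\<in>{1..hdim m n}. Re (intpi (\<lambda>x. qform (h m l x) (Hmat F G m x) (h m l x)))) else 0)}"

definition Delta :: "nat \<Rightarrow> nat \<Rightarrow> nat \<Rightarrow> (nat \<Rightarrow> nat \<Rightarrow> nat \<Rightarrow> complex) \<Rightarrow> (nat \<Rightarrow> nat \<Rightarrow> real \<Rightarrow> complex vec)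
    \<Rightarrow> (nat \<Rightarrow> real \<Rightarrow> complex mat) \<Rightarrow> (nat \<Rightarrow> real \<Rightarrow> complex mat) \<Rightarrow> real" where
  "Delta T N n a h F G = (\<Sum>m. if m \<in> Mset F G then
      (\<Sum>l\<in>{1..hdim m n}.
         Re (1 / (2 * pi) * intpi (\<lambda>x. qform (AN T N a m l x - h m l x) (F m x) (AN T N a m l x - h m l x)))
       + Re (1 / (2 * pi) * intpi (\<lambda>x. qform (h m l x) (G m x) (h m l x)))) else 0)"

end

theory Submission
  imports Defs "Jordan_Normal_Form.Determinant"
begin

text \<open>For each degree and each harmonic the mean-square error is, up to a constant, the squared
  distance in the Hilbert space with norm \<open>\<integral> h\<^sup>T H h*\<close>, and the characteristic is restricted to the
  subspace of functions without frequencies \<open>0, \<dots>, N\<close>. Put \<open>K = H\<inverse>\<close> and \<open>h\<^sub>0\<^sup>T = (A\<^sup>T F - C\<^sup>T) K\<close>.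
  Since \<open>C\<close> only has frequencies \<open>0, \<dots>, N\<close>, it is orthogonal to every admissible \<open>h\<close>, so
  \<open>\<integral> h\<^sub>0\<^sup>T H h* = \<integral> A\<^sup>T F h*\<close> and \<open>h\<^sub>0\<close> is the projection as soon as it is admissible itself. The
  vanishing of its frequencies \<open>0, \<dots>, N\<close> is the linear system \<open>B c = D a\<close>. It is solvable because
  \<open>c* B c = \<integral> C\<^sup>T K C* / 2\<pi>\<close> vanishes only for \<open>C = 0\<close>, that is for \<open>c = 0\<close>. Integrability rests
  on \<open>F K F \<le> F\<close> and on AM-GM for semidefinite forms, which bound the entries of \<open>F K\<close>, \<open>F K F\<close>
  and \<open>F K G = F - F K F\<close> by diagonal entries of \<open>F\<close> and \<open>K\<close>.\<close>

section \<open>Integration over the frequency interval\<close>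

text \<open>The entries of \<open>F\<close> and \<open>G\<close> are merely integrable, and a
  product of integrable functions need not be; the order bound on \<open>F K F\<close> takes the
  place of square integrability. Since \<open>H\<close> is invertible only almost everywhere, the
  algebra is done at a single frequency (locale \<open>psd_triple\<close>), then integrated for a
  single degree (locale \<open>spectral_pair\<close>), and the degrees are summed last. That
  summation is not automatic: \<open>suminf\<close> is informative only for convergent series, so
  comparing \<open>Delta\<close> at two characteristics requires convergence for the competitor as
  well as for the optimum. The operator formula comes from Pythagoras: up to the factor
  \<open>2 * pi\<close> the least error is the squared F-norm of \<open>A\<close> minus the squared
  H-norm of \<open>h\<^sub>0\<close>. Testing \<open>B c = D a\<close> with \<open>c\<close> turns
  the cross terms between \<open>A\<close> and \<open>C\<close> into multiples of
  \<open>c* B c\<close>, and what remains are the forms of \<open>K\<close> at \<open>C\<close> and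
  of \<open>F K G\<close> at \<open>A\<close>. Rows are stored as columns throughout:
  \<open>M\<^sup>T *\<^sub>v r\<close> stands for the row r M.\<close>

definition lpi :: "real measure" where
  "lpi = restrict_space lborel {-pi<..<pi}"

lemma space_lpi: "space lpi = {-pi<..<pi}"
  by (simp add: lpi_def space_restrict_space)

lemma finite_measure_lpi: "finite_measure lpi"
  by (rule finite_measureI) (simp add: space_lpi, simp add: lpi_def emeasure_restrict_space)

lemma borel_measurable_lpi: "f \<in> borel_measurable borel \<Longrightarrow> f \<in> borel_measurable lpi"
  unfolding lpi_def by (rule measurable_restrict_space1) simp

lemma Re_scale_two_pi: "Re (1 / (2 * pi) * z) = Re z / (2 * pi)" for z :: complex
  by simp

text \<open>Interval integrals are set integrals over the open interval between the endpoints. This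
  is why \<open>lpi\<close> restricts to the open interval; the closed one in the definitions of
  spectral densities and of \<open>Mset\<close> is larger only by the endpoints.\<close>

lemma intblepi_iff: "intblepi f \<longleftrightarrow> integrable lpi f"
  by (simp add: intblepi_def lpi_def interval_lebesgue_integrable_def integrable_restrict_space
      set_integrable_def)

lemma intpi_eq: "intpi f = integral\<^sup>L lpi f"
  by (simp add: intpi_def lpi_def interval_lebesgue_integral_def integral_restrict_space
      set_lebesgue_integral_def)

lemma AE_lpiI:
  assumes "AE x in lborel. x \<in> {-pi..pi} \<longrightarrow> P x"
  shows "AE x in lpi. P x"
  unfolding lpi_def using assms by (subst AE_restrict_space_iff) (auto elim: eventually_mono)

lemma AE_lpi_interval: "AE x in lpi. x \<in> {-pi..pi}"
  by (rule AE_I2) (simp add: space_lpi)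

abbreviation emode :: "nat \<Rightarrow> real \<Rightarrow> complex" where
  "emode j x \<equiv> exp (\<i> * of_nat j * complex_of_real x)"

lemma cnj_emode: "cnj (emode j x) = exp (- \<i> * of_nat j * complex_of_real x)"
  by (simp add: exp_cnj)

lemma measurable_emode: "emode j \<in> borel_measurable lpi"
  by (rule borel_measurable_lpi) measurable

lemma integrable_emode:
  assumes "integrable lpi f"
  shows "integrable lpi (\<lambda>x. f x * emode j x)" "integrable lpi (\<lambda>x. f x * cnj (emode j x))"
proof -
  show "integrable lpi (\<lambda>x. f x * emode j x)"
    using assms measurable_emode[of j]
    by (intro Bochner_Integration.integrable_bound[OF assms]) (auto simp: norm_mult)
  have "(\<lambda>x. cnj (emode j x)) \<in> borel_measurable lpi"
    unfolding cnj_emode by (rule borel_measurable_lpi) measurable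
  then show "integrable lpi (\<lambda>x. f x * cnj (emode j x))"
    using assms
    by (intro Bochner_Integration.integrable_bound[OF assms]) (auto simp: norm_mult exp_cnj)
qed

lemma integral_emode_ortho:
  "(\<integral>x. emode j x * cnj (emode k x) \<partial>lpi) = (if j = k then 2 * complex_of_real pi else 0)"
proof -
  define w where "w = (of_int (int j - int k) :: real)"
  have e: "emode j x * cnj (emode k x) = cis (w * x)" for x
    unfolding cnj_emode cis_conv_exp exp_add[symmetric] by (simp add: w_def algebra_simps)
  show ?thesis
  proof (cases "j = k")
    case True
    then show ?thesis
      unfolding e w_def using finite_measure_lpi
      by (simp add: lebesgue_integral_const measure_def space_lpi)
         (simp add: lpi_def emeasure_restrict_space scaleR_conv_of_real)
  next
    case False
    then have w0: "w \<noteq> 0" by (simp add: w_def)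
    have "(LBINT x=-pi..pi. cis (w * x)) = cis (w * pi) / (\<i> * w) - cis (w * (-pi)) / (\<i> * w)"
    proof (rule interval_integral_FTC_finite)
      show "continuous_on {min (- pi) pi..max (- pi) pi} (\<lambda>x. cis (w * x))"
        by (intro continuous_intros)
      show "((\<lambda>x. cis (w * x) / (\<i> * w)) has_vector_derivative cis (w * x))
              (at x within {min (- pi) pi..max (- pi) pi})" for x
        using w0 unfolding cis_conv_exp
        by (auto intro!: derivative_eq_intros has_vector_derivative_real_field simp: field_simps)
    qed
    \<comment> \<open>The two values can differ only in the sign of \<open>sin (w * pi)\<close>,
      which is 0 because \<open>w\<close> is an integer; so the boundary terms cancel.\<close>
    also have "cis (w * (-pi)) = cis (w * pi)"
      using sin_npi_int[of "int j - int k"] by (auto simp: w_def complex_eq_iff mult.commute)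
    finally show ?thesis
      unfolding e using False intpi_eq[of "\<lambda>x. cis (w * x)"] by (simp add: intpi_def)
  qed
qed

section \<open>Sesquilinear forms and positive semidefinite matrices\<close>

lemma square_mult_carrier:
  "A \<in> carrier_mat n n \<Longrightarrow> B \<in> carrier_mat n n \<Longrightarrow> A * B \<in> carrier_mat n n"
  by (rule mult_carrier_mat)

lemma transpose_mult_vec_carrier:
  "A \<in> carrier_mat n n \<Longrightarrow> v \<in> carrier_vec n \<Longrightarrow> A\<^sup>T *\<^sub>v v \<in> carrier_vec n"
  by (rule mult_mat_vec_carrier[of _ n n]) auto

lemma cvec_carrier [simp, intro]: "v \<in> carrier_vec n \<Longrightarrow> cvec v \<in> carrier_vec n"
  by (simp add: cvec_def)

lemma dim_cvec [simp]: "dim_vec (cvec v) = dim_vec v"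
  by (simp add: cvec_def)

lemma cvec_cvec [simp]: "cvec (cvec v) = v"
  by (intro eq_vecI) (auto simp: cvec_def)

lemma index_cvec [simp]: "i < dim_vec v \<Longrightarrow> cvec v $ i = cnj (v $ i)"
  by (simp add: cvec_def)

lemma cvec_minus: "dim_vec v = dim_vec w \<Longrightarrow> cvec (v - w) = cvec v - cvec w"
  by (intro eq_vecI) (auto simp: cvec_def)

lemma qform_sum:
  assumes "r \<in> carrier_vec n" "A \<in> carrier_mat n n" "s \<in> carrier_vec n"
  shows "qform r A s = (\<Sum>p<n. \<Sum>q<n. r $ p * A $$ (p,q) * cnj (s $ q))"
  using assms
  by (auto simp: qform_def scalar_prod_def sum_distrib_left lessThan_atLeast0 mult.assoc
      intro!: sum.cong)

lemma qform_minus_left: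
  assumes "r \<in> carrier_vec n" "r' \<in> carrier_vec n" "A \<in> carrier_mat n n" "s \<in> carrier_vec n"
  shows "qform (r - r') A s = qform r A s - qform r' A s"
  using assms unfolding qform_def by (intro minus_scalar_prod_distrib) auto

lemma qform_minus_right:
  assumes "r \<in> carrier_vec n" "A \<in> carrier_mat n n" "s \<in> carrier_vec n" "s' \<in> carrier_vec n"
  shows "qform r A (s - s') = qform r A s - qform r A s'"
  using assms unfolding qform_def
  by (simp add: cvec_minus mult_minus_distrib_mat_vec[of _ n n] scalar_prod_minus_distrib[of _ n])

lemma qform_add_mid:
  assumes "r \<in> carrier_vec n" "A \<in> carrier_mat n n" "B \<in> carrier_mat n n" "s \<in> carrier_vec n"
  shows "qform r (A + B) s = qform r A s + qform r B s"
  using assms unfolding qform_def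
  by (simp add: add_mult_distrib_mat_vec[of _ n n] scalar_prod_add_distrib[of _ n])

lemma qform_minus_mid:
  assumes "r \<in> carrier_vec n" "A \<in> carrier_mat n n" "B \<in> carrier_mat n n" "s \<in> carrier_vec n"
  shows "qform r (A - B) s = qform r A s - qform r B s"
  using assms unfolding qform_def
  by (simp add: minus_mult_distrib_mat_vec[of _ n n] scalar_prod_minus_distrib[of _ n])

lemma qform_smult:
  assumes "r \<in> carrier_vec n" "A \<in> carrier_mat n n" "s \<in> carrier_vec n"
  shows "qform (c \<cdot>\<^sub>v r) A s = c * qform r A s" "qform r A (c \<cdot>\<^sub>v s) = cnj c * qform r A s"
  using assms by (simp_all add: qform_sum[of _ n] sum_distrib_left mult_ac)

lemma qform_one:
  assumes "r \<in> carrier_vec n" "s \<in> carrier_vec n"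
  shows "qform r (1\<^sub>m n) s = scalar_prod r (cvec s)"
  using assms by (simp add: qform_def)

lemma qform_unit_vec:
  assumes "A \<in> carrier_mat n n" "p < n" "q < n"
  shows "qform (unit_vec n p) A (unit_vec n q) = A $$ (p,q)"
proof -
  have "cvec (unit_vec n q) = unit_vec n q"
    by (intro eq_vecI) (auto simp: unit_vec_def)
  then show ?thesis
    using assms by (simp add: qform_def scalar_prod_left_unit[of _ n])
qed

text \<open>With \<open>A\<^sup>T *\<^sub>v r\<close> read as the row r A, this is associativity of
  the product r A B s*.\<close>

lemma qform_transpose_left:
  assumes "r \<in> carrier_vec n" "A \<in> carrier_mat n n" "B \<in> carrier_mat n n" "s \<in> carrier_vec n"
  shows "qform (A\<^sup>T *\<^sub>v r) B s = qform r (A * B) s"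
proof -
  have "qform (A\<^sup>T *\<^sub>v r) B s = scalar_prod (B *\<^sub>v cvec s) (A\<^sup>T *\<^sub>v r)"
    using assms unfolding qform_def by (intro comm_scalar_prod[of _ n]) auto
  also have "\<dots> = scalar_prod (A *\<^sub>v (B *\<^sub>v cvec s)) r"
    using assms transpose_vec_mult_scalar[of "A\<^sup>T" n n r "B *\<^sub>v cvec s"] by simp
  also have "\<dots> = scalar_prod r (A *\<^sub>v (B *\<^sub>v cvec s))"
    using assms by (intro comm_scalar_prod[of _ n]) auto
  finally show ?thesis
    using assms by (simp add: qform_def assoc_mult_mat_vec[of _ n n _ n])
qed

section \<open>Hermitian positive semidefinite matrices\<close>

definition hermitian_psd :: "nat \<Rightarrow> complex mat \<Rightarrow> bool" where
  "hermitian_psd n A \<longleftrightarrow> A \<in> carrier_mat n n \<and> (\<forall>p<n. \<forall>q<n. A $$ (p,q) = cnj (A $$ (q,p)))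
     \<and> (\<forall>v\<in>carrier_vec n. 0 \<le> Re (qform v A v))"

lemma hermitian_psd_carrier: "hermitian_psd n A \<Longrightarrow> A \<in> carrier_mat n n"
  by (simp add: hermitian_psd_def)

lemma hermitian_psd_cnj:
  "hermitian_psd n A \<Longrightarrow> p < n \<Longrightarrow> q < n \<Longrightarrow> cnj (A $$ (q,p)) = A $$ (p,q)"
  unfolding hermitian_psd_def by metis

lemma hermitian_psd_nonneg: "hermitian_psd n A \<Longrightarrow> v \<in> carrier_vec n \<Longrightarrow> 0 \<le> Re (qform v A v)"
  by (simp add: hermitian_psd_def)

lemma qform_swap:
  assumes A: "hermitian_psd n A" and "r \<in> carrier_vec n" "s \<in> carrier_vec n"
  shows "qform s A r = cnj (qform r A s)"
proof -
  have "qform s A r = (\<Sum>p<n. \<Sum>q<n. s $ p * A $$ (p,q) * cnj (r $ q))"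
    using assms by (intro qform_sum hermitian_psd_carrier)
  also have "\<dots> = (\<Sum>p<n. \<Sum>q<n. cnj (r $ q * A $$ (q,p) * cnj (s $ p)))"
  proof (intro sum.cong refl)
    fix p q assume "p \<in> {..<n}" "q \<in> {..<n}"
    then have "cnj (A $$ (q,p)) = A $$ (p,q)"
      using hermitian_psd_cnj[OF A] by simp
    then show "s $ p * A $$ (p,q) * cnj (r $ q) = cnj (r $ q * A $$ (q,p) * cnj (s $ p))"
      by simp
  qed
  also have "\<dots> = cnj (\<Sum>q<n. \<Sum>p<n. r $ q * A $$ (q,p) * cnj (s $ p))"
    by (subst sum.swap) simp
  also have "\<dots> = cnj (qform r A s)"
    using assms by (simp add: qform_sum[of _ n] hermitian_psd_carrier)
  finally show ?thesis .
qed

lemma qform_self_real: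
  assumes "hermitian_psd n A" "v \<in> carrier_vec n"
  shows "qform v A v = complex_of_real (Re (qform v A v))"
  using qform_swap[OF assms assms(2)] by (simp add: complex_eq_iff)

text \<open>The second argument of \<open>qform\<close> is conjugated, so conjugating
  \<open>A\<^sup>T *\<^sub>v s\<close> produces the adjoint of \<open>A\<close>; for Hermitian
  \<open>A\<close> this is \<open>A\<close> itself.\<close>

lemma qform_transpose_right:
  assumes A: "hermitian_psd n A" and "r \<in> carrier_vec n" "B \<in> carrier_mat n n" "s \<in> carrier_vec n"
  shows "qform r B (A\<^sup>T *\<^sub>v s) = qform r (B * A) s"
proof -
  have c: "A \<in> carrier_mat n n" using A by (rule hermitian_psd_carrier)
  have "cvec (A\<^sup>T *\<^sub>v s) = A *\<^sub>v cvec s"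
  proof (rule eq_vecI)
    fix i assume "i < dim_vec (A *\<^sub>v cvec s)"
    then have i: "i < n" using c by simp
    have "(\<Sum>q<n. cnj (A $$ (q,i)) * cnj (s $ q)) = (\<Sum>q<n. A $$ (i,q) * cnj (s $ q))"
      using i by (intro sum.cong) (auto simp: hermitian_psd_cnj[OF A])
    then show "cvec (A\<^sup>T *\<^sub>v s) $ i = (A *\<^sub>v cvec s) $ i"
      using c i assms by (simp add: scalar_prod_def lessThan_atLeast0)
  qed (use c in auto)
  then show ?thesis
    using assms c by (simp add: qform_def assoc_mult_mat_vec[of _ n n _ n])
qed

text \<open>The phase \<open>u\<close> of \<open>z\<close> rotates \<open>s\<close> so that the
  cross term becomes the real number \<open>cmod z\<close>. Nonnegativity of the form at
  \<open>r - u \<cdot>\<^sub>v s\<close> is then the inequality. The additive form, unlike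
  Cauchy-Schwarz, yields bounds that are sums of integrable functions.\<close>

lemma qform_AMGM:
  assumes A: "hermitian_psd n A" and r: "r \<in> carrier_vec n" and s: "s \<in> carrier_vec n"
  shows "2 * cmod (qform r A s) \<le> Re (qform r A r) + Re (qform s A s)"
proof (cases "qform r A s = 0")
  case True
  then show ?thesis
    using hermitian_psd_nonneg[OF A r] hermitian_psd_nonneg[OF A s] by simp
next
  case False
  note c = hermitian_psd_carrier[OF A]
  define z where "z = qform r A s"
  define u where "u = z / cmod z"
  have z: "z \<noteq> 0" using False by (simp add: z_def)
  have u: "cnj u * z = cmod z" "u * cnj u = 1"
    using z by (simp_all add: u_def complex_norm_square[symmetric] field_simps power2_eq_square
        flip: of_real_mult)
  have us: "u \<cdot>\<^sub>v s \<in> carrier_vec n" using s by simp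
  have "qform (r - u \<cdot>\<^sub>v s) A (r - u \<cdot>\<^sub>v s)
      = qform r A r - cnj u * z - u * cnj z + u * cnj u * qform s A s"
    using r s us c qform_swap[OF A r s]
    by (simp add: qform_minus_left[of _ n] qform_minus_right[of _ n] qform_smult[of _ n] z_def
        algebra_simps)
  also have "u * cnj z = cnj (cnj u * z)" by simp
  finally have "Re (qform (r - u \<cdot>\<^sub>v s) A (r - u \<cdot>\<^sub>v s)) = Re (qform r A r) + Re (qform s A s) - 2 * cmod z"
    unfolding u by simp
  moreover have "0 \<le> Re (qform (r - u \<cdot>\<^sub>v s) A (r - u \<cdot>\<^sub>v s))"
    using hermitian_psd_nonneg[OF A] r us by simp
  ultimately show ?thesis by (simp add: z_def)
qed

lemma qform_degenerate:
  assumes A: "hermitian_psd n A" and r: "r \<in> carrier_vec n" and s: "s \<in> carrier_vec n"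
    and 0: "qform r A r = 0"
  shows "qform s A r = 0"
proof (rule ccontr)
  assume n0: "qform s A r \<noteq> 0"
  define b where "b = cmod (qform s A r)"
  have b: "b > 0" using n0 by (simp add: b_def)
  \<comment> \<open>rescaling \<open>r\<close> by a large \<open>t\<close> violates the AM-GM inequality\<close>
  define t where "t = (Re (qform s A s) + 1) / b"
  have t: "t \<ge> 0" using b hermitian_psd_nonneg[OF A s] by (simp add: t_def)
  have "2 * cmod (qform s A (complex_of_real t \<cdot>\<^sub>v r)) \<le> Re (qform s A s)"
    using qform_AMGM[OF A s, of "complex_of_real t \<cdot>\<^sub>v r"] r 0 hermitian_psd_carrier[OF A]
    by (simp add: qform_smult[of _ n])
  then have "2 * (t * b) \<le> Re (qform s A s)"
    using r s hermitian_psd_carrier[OF A] t by (simp add: qform_smult[of _ n] norm_mult b_def)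
  moreover have "t * b = Re (qform s A s) + 1" using b by (simp add: t_def)
  ultimately show False using hermitian_psd_nonneg[OF A s] by simp
qed

lemma hermitian_psd_add:
  assumes "hermitian_psd n A" "hermitian_psd n B"
  shows "hermitian_psd n (A + B)"
  unfolding hermitian_psd_def
proof (intro conjI allI impI ballI)
  note c = hermitian_psd_carrier[OF assms(1)] hermitian_psd_carrier[OF assms(2)]
  show "A + B \<in> carrier_mat n n" using c by simp
  show "(A + B) $$ (p,q) = cnj ((A + B) $$ (q,p))" if "p < n" "q < n" for p q
    using that c by (simp add: hermitian_psd_cnj[OF assms(1)] hermitian_psd_cnj[OF assms(2)])
  show "0 \<le> Re (qform v (A + B) v)" if "v \<in> carrier_vec n" for v
    using that c assms by (simp add: qform_add_mid[of _ n] hermitian_psd_nonneg)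
qed

section \<open>Inverses of Hermitian positive semidefinite matrices\<close>

lemma minv_inverse:
  assumes A: "A \<in> carrier_mat n n" and "mat_inverse A \<noteq> None"
  shows "A * minv A = 1\<^sub>m n" "minv A * A = 1\<^sub>m n"
  using assms mat_inverse(2)[OF A] by (auto simp: minv_def)

lemma minv_carrier:
  assumes A: "A \<in> carrier_mat n n"
  shows "minv A \<in> carrier_mat n n"
  using A mat_inverse(2)[OF A] by (auto simp: minv_def split: option.split)

text \<open>Valid for singular matrices too, where both sides are \<open>0\<close> since \<open>1 / 0 = 0\<close>;
  hence the entries of an inverse are measurable functions without any case distinction.\<close>

lemma minv_eq_adj:
  assumes A: "A \<in> carrier_mat n n"
  shows "minv A = (1 / det A) \<cdot>\<^sub>m adj_mat A"
proof (cases "det A = 0")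
  case True
  have "mat_inverse A = None"
  proof (rule ccontr)
    assume "mat_inverse A \<noteq> None"
    then have "det (A * minv A) = 1" using minv_inverse[OF A] by simp
    then show False using True A minv_carrier[OF A] by (simp add: det_mult[of _ n])
  qed
  then show ?thesis using True A adj_mat(1)[OF A]
    by (intro eq_matI) (auto simp: minv_def)
next
  case False
  note a = adj_mat[OF A]
  have "mat_inverse A \<noteq> None"
    using det_non_zero_imp_unit[OF A False, where b="()"] mat_inverse(1)[OF A, where b="()"] by blast
  note i = minv_inverse[OF A this]
  have "(1 / det A) \<cdot>\<^sub>m (A * adj_mat A) = 1\<^sub>m n"
    using False by (intro eq_matI) (auto simp: a(2))
  then have "minv A = minv A * ((1 / det A) \<cdot>\<^sub>m (A * adj_mat A))"
    using minv_carrier[OF A] by simp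
  also have "\<dots> = (1 / det A) \<cdot>\<^sub>m (minv A * A * adj_mat A)"
    using mult_smult_distrib[OF minv_carrier[OF A] square_mult_carrier[OF A a(1)]]
      assoc_mult_mat[OF minv_carrier[OF A] A a(1)] by simp
  also have "\<dots> = (1 / det A) \<cdot>\<^sub>m adj_mat A"
    unfolding i using a(1) by simp
  finally show ?thesis .
qed

lemma hermitian_psd_inverse:
  assumes H: "hermitian_psd n H" and K: "K \<in> carrier_mat n n"
    and HK: "H * K = 1\<^sub>m n" and KH: "K * H = 1\<^sub>m n"
  shows "hermitian_psd n K"
proof -
  note c = hermitian_psd_carrier[OF H]
  \<comment> \<open>the adjoint of \<open>K\<close> is also a left inverse of \<open>H\<close>\<close>
  define K' where "K' = mat n n (\<lambda>(p,q). cnj (K $$ (q,p)))"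
  have K': "K' \<in> carrier_mat n n" by (simp add: K'_def)
  have "K' * H = 1\<^sub>m n"
  proof (rule eq_matI)
    fix p q assume "p < dim_row (1\<^sub>m n :: complex mat)" "q < dim_col (1\<^sub>m n :: complex mat)"
    then have pq: "p < n" "q < n" by auto
    have "(K' * H) $$ (p,q) = (\<Sum>k<n. cnj (K $$ (k,p)) * H $$ (k,q))"
      using pq c K by (simp add: K'_def scalar_prod_def lessThan_atLeast0)
    also have "\<dots> = (\<Sum>k<n. cnj (H $$ (q,k) * K $$ (k,p)))"
      using pq by (intro sum.cong) (auto simp: hermitian_psd_cnj[OF H] mult.commute)
    also have "\<dots> = cnj ((H * K) $$ (q,p))"
      using pq c K by (simp add: scalar_prod_def lessThan_atLeast0)
    also have "\<dots> = 1\<^sub>m n $$ (p,q)" using pq by (simp add: HK)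
    finally show "(K' * H) $$ (p,q) = 1\<^sub>m n $$ (p,q)" .
  qed (use c K' in auto)
  then have "K' * H * K = K" using K by simp
  then have eq: "K' = K" using K' K c by (simp add: assoc_mult_mat[of _ n n _ n] HK)
  have herm: "K $$ (p,q) = cnj (K $$ (q,p))" if "p < n" "q < n" for p q
  proof -
    have "K' $$ (p,q) = cnj (K $$ (q,p))" using that by (simp add: K'_def)
    then show ?thesis by (simp only: eq)
  qed
  have "0 \<le> Re (qform v K v)" if v: "v \<in> carrier_vec n" for v
  proof -
    \<comment> \<open>Chosen so that \<open>H\<close> maps \<open>cvec w\<close> to
      \<open>cvec v\<close>. The form of \<open>H\<close> at \<open>w\<close> is then the conjugate
      of the form of \<open>K\<close> at \<open>v\<close>, with the same real part.\<close>
    define w where "w = cvec (K *\<^sub>v cvec v)"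
    have w: "w \<in> carrier_vec n"
      unfolding w_def using K v by (intro cvec_carrier mult_mat_vec_carrier[of _ n n])
    have wv: "H *\<^sub>v cvec w = cvec v"
      using K c v by (simp add: w_def assoc_mult_mat_vec[of _ n n _ n, symmetric] HK)
    have "qform w H w = scalar_prod w (cvec v)" by (simp add: qform_def wv)
    also have "\<dots> = scalar_prod (cvec v) w" using w v by (intro comm_scalar_prod[of _ n]) auto
    also have "\<dots> = cnj (scalar_prod v (cvec w))"
      using w v by (simp add: scalar_prod_def)
    also have "\<dots> = cnj (qform v K v)" by (simp add: qform_def w_def)
    finally show ?thesis using hermitian_psd_nonneg[OF H w] by simp
  qed
  then show ?thesis using K herm unfolding hermitian_psd_def by blast
qed

lemma sandwich_le:
  assumes F: "hermitian_psd n F" and G: "hermitian_psd n G" and K: "hermitian_psd n K"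
    and HK: "(F + G) * K = 1\<^sub>m n" and v: "v \<in> carrier_vec n"
  shows "Re (qform v (F * K * F) v) \<le> Re (qform v F v)"
proof -
  note c = hermitian_psd_carrier[OF F] hermitian_psd_carrier[OF G] hermitian_psd_carrier[OF K]
  \<comment> \<open>with \<open>w = K F v\<close>: \<open>w* H w = w* F v \<le> (w* F w + v* F v) / 2 \<le> (w* H w + v* F v) / 2\<close>\<close>
  define w where "w = (F * K)\<^sup>T *\<^sub>v v"
  have w: "w \<in> carrier_vec n"
    unfolding w_def using c v
    by (intro mult_mat_vec_carrier[of _ n n] transpose_carrier_mat[THEN iffD2] mult_carrier_mat[of _ n n])
  have w2: "w = K\<^sup>T *\<^sub>v (F\<^sup>T *\<^sub>v v)"
    unfolding w_def transpose_mult[OF c(1) c(3)]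
    by (rule assoc_mult_mat_vec[of _ n n _ n]) (use c v in auto)
  have FG: "F + G \<in> carrier_mat n n" using c by simp
  have u: "F\<^sup>T *\<^sub>v v \<in> carrier_vec n" by (rule transpose_mult_vec_carrier[OF c(1) v])
  have "qform w (F + G) w = qform (F\<^sup>T *\<^sub>v v) (K * (F + G)) w"
    using qform_transpose_left[OF u c(3) FG w] by (simp add: w2)
  also have "\<dots> = qform (F\<^sup>T *\<^sub>v v) (K * (F + G) * K) (F\<^sup>T *\<^sub>v v)"
    unfolding w2 by (rule qform_transpose_right[OF K u square_mult_carrier[OF c(3) FG] u])
  also have "K * (F + G) * K = K"
    using assoc_mult_mat[OF c(3) FG c(3)] c(3) by (simp add: HK)
  also have "qform (F\<^sup>T *\<^sub>v v) K (F\<^sup>T *\<^sub>v v) = qform v (F * K) (F\<^sup>T *\<^sub>v v)"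
    by (rule qform_transpose_left[OF v c(1) c(3) u])
  also have "\<dots> = qform v (F * K * F) v"
    by (rule qform_transpose_right[OF F v square_mult_carrier[OF c(1) c(3)] v])
  finally have 1: "qform w (F + G) w = qform v (F * K * F) v" .
  have 2: "qform w F v = qform v (F * K * F) v"
    unfolding w_def by (rule qform_transpose_left[OF v square_mult_carrier[OF c(1) c(3)] c(1) v])
  have "Re (qform w (F + G) w) = Re (qform w F w) + Re (qform w G w)"
    unfolding qform_add_mid[OF w c(1) c(2) w] by simp
  moreover have "2 * Re (qform v (F * K * F) v) \<le> Re (qform w F w) + Re (qform v F v)"
    using qform_AMGM[OF F w v] complex_Re_le_cmod[of "qform w F v"] unfolding 2 by argo
  ultimately show ?thesis
    using hermitian_psd_nonneg[OF G w] unfolding 1 by argo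
qed

section \<open>Measurability of vector and matrix functions\<close>

definition vec_measurable :: "nat \<Rightarrow> (real \<Rightarrow> complex vec) \<Rightarrow> bool" where
  "vec_measurable n r \<longleftrightarrow> (\<forall>x. r x \<in> carrier_vec n) \<and> (\<forall>p<n. (\<lambda>x. r x $ p) \<in> borel_measurable lpi)"

definition mat_measurable :: "nat \<Rightarrow> (real \<Rightarrow> complex mat) \<Rightarrow> bool" where
  "mat_measurable n A \<longleftrightarrow> (\<forall>x. A x \<in> carrier_mat n n)
     \<and> (\<forall>p<n. \<forall>q<n. (\<lambda>x. A x $$ (p,q)) \<in> borel_measurable lpi)"

definition mat_integrable :: "nat \<Rightarrow> (real \<Rightarrow> complex mat) \<Rightarrow> bool" where
  "mat_integrable n A \<longleftrightarrow> (\<forall>x. A x \<in> carrier_mat n n)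
     \<and> (\<forall>p<n. \<forall>q<n. integrable lpi (\<lambda>x. A x $$ (p,q)))"

lemma mat_integrable_imp_measurable: "mat_integrable n A \<Longrightarrow> mat_measurable n A"
  by (auto simp: mat_integrable_def mat_measurable_def intro: borel_measurable_integrable)

lemma vec_measurable_carrier: "vec_measurable n r \<Longrightarrow> r x \<in> carrier_vec n"
  by (simp add: vec_measurable_def)

lemma mat_measurable_carrier: "mat_measurable n A \<Longrightarrow> A x \<in> carrier_mat n n"
  by (simp add: mat_measurable_def)

lemma qform_measurable:
  assumes r: "vec_measurable n r" and A: "mat_measurable n A" and s: "vec_measurable n s"
  shows "(\<lambda>x. qform (r x) (A x) (s x)) \<in> borel_measurable lpi"
proof -
  have [measurable]: "(\<lambda>x. r x $ p) \<in> borel_measurable lpi" "(\<lambda>x. s x $ p) \<in> borel_measurable lpi"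
    if "p < n" for p
    using r s that by (simp_all add: vec_measurable_def)
  have m: "(\<lambda>x. cnj (s x $ p)) \<in> borel_measurable lpi" if "p < n" for p
    by (rule measurable_compose[of "\<lambda>x. s x $ p" lpi borel cnj])
      (use s that in \<open>auto simp: vec_measurable_def intro!: borel_measurable_continuous_onI continuous_intros\<close>)
  show ?thesis
    using r A s m
    unfolding qform_sum[OF vec_measurable_carrier[OF r] mat_measurable_carrier[OF A] vec_measurable_carrier[OF s]]
    by (intro borel_measurable_sum borel_measurable_times)
       (auto simp: vec_measurable_def mat_measurable_def)
qed

lemma mat_measurable_mult:
  assumes A: "mat_measurable n A" and B: "mat_measurable n B"
  shows "mat_measurable n (\<lambda>x. A x * B x)"
  unfolding mat_measurable_def
proof (intro conjI allI impI)
  note c = mat_measurable_carrier[OF A] mat_measurable_carrier[OF B]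
  show "A x * B x \<in> carrier_mat n n" for x by (rule square_mult_carrier[OF c])
  fix p q assume pq: "p < n" "q < n"
  have "(A x * B x) $$ (p,q) = (\<Sum>k<n. A x $$ (p,k) * B x $$ (k,q))" for x
    using c(1)[of x] c(2)[of x] pq by (simp add: scalar_prod_def lessThan_atLeast0)
  then show "(\<lambda>x. (A x * B x) $$ (p,q)) \<in> borel_measurable lpi"
    using A B pq by (auto simp: mat_measurable_def intro!: borel_measurable_sum borel_measurable_times)
qed

lemma mat_measurable_add:
  assumes A: "mat_measurable n A" and B: "mat_measurable n B"
  shows "mat_measurable n (\<lambda>x. A x + B x)"
  unfolding mat_measurable_def
proof (intro conjI allI impI)
  note c = mat_measurable_carrier[OF A] mat_measurable_carrier[OF B]
  show "A x + B x \<in> carrier_mat n n" for x using c[of x] by simp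
  fix p q assume pq: "p < n" "q < n"
  have "(A x + B x) $$ (p,q) = A x $$ (p,q) + B x $$ (p,q)" for x
    using c(1)[of x] c(2)[of x] pq by simp
  then show "(\<lambda>x. (A x + B x) $$ (p,q)) \<in> borel_measurable lpi"
    using A B pq by (auto simp: mat_measurable_def intro!: borel_measurable_add)
qed

lemma vec_measurable_minus:
  assumes r: "vec_measurable n r" and s: "vec_measurable n s"
  shows "vec_measurable n (\<lambda>x. r x - s x)"
  unfolding vec_measurable_def
proof (intro conjI allI impI)
  note c = vec_measurable_carrier[OF r] vec_measurable_carrier[OF s]
  show "r x - s x \<in> carrier_vec n" for x using c[of x] by simp
  fix p assume p: "p < n"
  have "(r x - s x) $ p = r x $ p - s x $ p" for x
    using c(1)[of x] c(2)[of x] p by simp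
  then show "(\<lambda>x. (r x - s x) $ p) \<in> borel_measurable lpi"
    using r s p by (auto simp: vec_measurable_def intro!: borel_measurable_diff)
qed

lemma index_transpose_mult_vec:
  assumes "A \<in> carrier_mat n n" "r \<in> carrier_vec n" "p < n"
  shows "(A\<^sup>T *\<^sub>v r) $ p = (\<Sum>q<n. A $$ (q,p) * r $ q)"
  using assms by (simp add: scalar_prod_def lessThan_atLeast0)

lemma vec_measurable_transpose_mult:
  assumes A: "mat_measurable n A" and r: "vec_measurable n r"
  shows "vec_measurable n (\<lambda>x. (A x)\<^sup>T *\<^sub>v r x)"
  unfolding vec_measurable_def
proof (intro conjI allI impI)
  note c = mat_measurable_carrier[OF A] vec_measurable_carrier[OF r]
  show "(A x)\<^sup>T *\<^sub>v r x \<in> carrier_vec n" for x by (rule transpose_mult_vec_carrier[OF c])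
  fix p assume p: "p < n"
  show "(\<lambda>x. ((A x)\<^sup>T *\<^sub>v r x) $ p) \<in> borel_measurable lpi"
    unfolding index_transpose_mult_vec[OF c p]
    using A r p by (auto simp: mat_measurable_def vec_measurable_def
        intro!: borel_measurable_sum borel_measurable_times)
qed

lemma det_measurable:
  assumes A: "mat_measurable n A"
  shows "(\<lambda>x. det (A x)) \<in> borel_measurable lpi"
proof -
  have "(\<lambda>x. A x $$ (i, p i)) \<in> borel_measurable lpi" if "p permutes {0..<n}" "i \<in> {0..<n}" for p i
    using that A permutes_in_image[OF that(1), of i] by (auto simp: mat_measurable_def)
  then show ?thesis
    unfolding det_def'[OF mat_measurable_carrier[OF A]]
    by (intro borel_measurable_sum borel_measurable_times borel_measurable_prod borel_measurable_const) auto
qed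

lemma minv_measurable:
  assumes A: "mat_measurable n A"
  shows "mat_measurable n (\<lambda>x. minv (A x))"
  unfolding mat_measurable_def
proof (intro conjI allI impI)
  note c = mat_measurable_carrier[OF A]
  show "minv (A x) \<in> carrier_mat n n" for x by (rule minv_carrier[OF c])
  fix p q assume pq: "p < n" "q < n"
  have "mat_measurable (n - 1) (\<lambda>x. mat_delete (A x) q p)"
    unfolding mat_measurable_def
  proof (intro conjI allI impI)
    show "mat_delete (A x) q p \<in> carrier_mat (n - 1) (n - 1)" for x
      using c[of x] by (simp add: mat_delete_def)
    fix i j assume ij: "i < n - 1" "j < n - 1"
    have "mat_delete (A x) q p $$ (i,j) = A x $$ (if i < q then i else Suc i, if j < p then j else Suc j)" for x
      using c[of x] ij by (simp add: mat_delete_def)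
    then show "(\<lambda>x. mat_delete (A x) q p $$ (i,j)) \<in> borel_measurable lpi"
      using A ij by (auto simp: mat_measurable_def)
  qed
  note m = det_measurable[OF this]
  have "minv (A x) $$ (p,q) = 1 / det (A x) * ((-1) ^ (q + p) * det (mat_delete (A x) q p))" for x
    using c[of x] pq by (simp add: minv_eq_adj[of _ n] adj_mat_def cofactor_def)
  then show "(\<lambda>x. minv (A x) $$ (p,q)) \<in> borel_measurable lpi"
    using m det_measurable[OF A]
    by (auto intro!: borel_measurable_times borel_measurable_divide)
qed

lemma integrable_dominated:
  fixes f :: "real \<Rightarrow> complex" and g :: "real \<Rightarrow> real"
  assumes "integrable lpi g" "f \<in> borel_measurable lpi" "AE x in lpi. cmod (f x) \<le> g x"
  shows "integrable lpi f"
  using assms(3) by (intro Bochner_Integration.integrable_bound[OF assms(1,2)]) (auto elim: eventually_mono)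

text \<open>Plays the part of Cauchy-Schwarz in the space with weight \<open>A\<close>: two
  functions of finite norm have an integrable inner product, by the pointwise AM-GM bound.\<close>

lemma qform_integrable_AMGM:
  assumes r: "vec_measurable n r" and A: "mat_measurable n A" and s: "vec_measurable n s"
    and psd: "AE x in lpi. hermitian_psd n (A x)"
    and ir: "integrable lpi (\<lambda>x. qform (r x) (A x) (r x))"
    and iss: "integrable lpi (\<lambda>x. qform (s x) (A x) (s x))"
  shows "integrable lpi (\<lambda>x. qform (r x) (A x) (s x))"
proof (rule integrable_dominated)
  show "integrable lpi (\<lambda>x. Re (qform (r x) (A x) (r x)) + Re (qform (s x) (A x) (s x)))"
    using ir iss by (intro Bochner_Integration.integrable_add integrable_Re)
  show "(\<lambda>x. qform (r x) (A x) (s x)) \<in> borel_measurable lpi"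
    by (rule qform_measurable[OF r A s])
  show "AE x in lpi. cmod (qform (r x) (A x) (s x))
      \<le> Re (qform (r x) (A x) (r x)) + Re (qform (s x) (A x) (s x))"
    using psd
  proof (rule eventually_mono)
    fix x assume "hermitian_psd n (A x)"
    from qform_AMGM[OF this vec_measurable_carrier[OF r] vec_measurable_carrier[OF s], of x x]
    show "cmod (qform (r x) (A x) (s x)) \<le> Re (qform (r x) (A x) (r x)) + Re (qform (s x) (A x) (s x))"
      using norm_ge_zero[of "qform (r x) (A x) (s x)"] by argo
  qed
qed

section \<open>Trigonometric vector polynomials and block Toeplitz operators\<close>

text \<open>The common shape of \<open>AN\<close> and \<open>CN\<close>: block \<open>j\<close> of
  the flat vector \<open>c\<close> occupies the positions from \<open>j * T\<close> on and is the
  coefficient vector at frequency \<open>j\<close>.\<close>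

definition tvec :: "nat \<Rightarrow> nat \<Rightarrow> complex vec \<Rightarrow> real \<Rightarrow> complex vec" where
  "tvec T N c x = vec T (\<lambda>p. \<Sum>j\<le>N. c $ (j * T + p) * emode j x)"

lemma tvec_measurable: "vec_measurable T (tvec T N c)"
  using measurable_emode by (auto simp: vec_measurable_def tvec_def
      intro!: borel_measurable_sum borel_measurable_times)

lemma tvec_carrier: "tvec T N c x \<in> carrier_vec T"
  by (simp add: tvec_def)

lemma integrable_tvec:
  assumes f: "integrable lpi f" and p: "p < T"
  shows "integrable lpi (\<lambda>x. f x * tvec T N c x $ p)"
    and "integrable lpi (\<lambda>x. f x * cnj (tvec T N c x $ p))"
proof -
  have "integrable lpi (\<lambda>x. \<Sum>j\<le>N. c $ (j * T + p) * (f x * emode j x))"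
    by (intro Bochner_Integration.integrable_sum integrable_mult_right integrable_emode f)
  moreover have "(\<Sum>j\<le>N. c $ (j * T + p) * (f x * emode j x)) = f x * tvec T N c x $ p" for x
    using p by (simp add: tvec_def sum_distrib_left mult_ac)
  ultimately show "integrable lpi (\<lambda>x. f x * tvec T N c x $ p)" by simp
  have "integrable lpi (\<lambda>x. \<Sum>j\<le>N. cnj (c $ (j * T + p)) * (f x * cnj (emode j x)))"
    by (intro Bochner_Integration.integrable_sum integrable_mult_right integrable_emode f)
  moreover have "(\<Sum>j\<le>N. cnj (c $ (j * T + p)) * (f x * cnj (emode j x))) = f x * cnj (tvec T N c x $ p)" for x
    using p by (simp add: tvec_def sum_distrib_left mult_ac)
  ultimately show "integrable lpi (\<lambda>x. f x * cnj (tvec T N c x $ p))" by simp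
qed

lemma transpose_tvec_integrable:
  assumes A: "mat_integrable T A" and p: "p < T"
  shows "integrable lpi (\<lambda>x. ((A x)\<^sup>T *\<^sub>v tvec T N c x) $ p)"
proof -
  have c: "A x \<in> carrier_mat T T" for x using A by (simp add: mat_integrable_def)
  show ?thesis
    unfolding index_transpose_mult_vec[OF c tvec_carrier p]
    using A p by (auto simp: mat_integrable_def intro!: Bochner_Integration.integrable_sum integrable_tvec)
qed

lemma qform_tvec_integrable:
  assumes A: "mat_integrable T A"
  shows "integrable lpi (\<lambda>x. qform (tvec T N c x) (A x) (tvec T N d x))"
proof -
  have "A x \<in> carrier_mat T T" for x using A by (simp add: mat_integrable_def)
  then have "qform (tvec T N c x) (A x) (tvec T N d x)
      = (\<Sum>p<T. \<Sum>q<T. A x $$ (p,q) * tvec T N c x $ p * cnj (tvec T N d x $ q))" for x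
    by (simp add: qform_sum[OF tvec_carrier _ tvec_carrier] mult_ac)
  then show ?thesis
    using A by (auto simp: mat_integrable_def intro!: Bochner_Integration.integrable_sum integrable_tvec)
qed

lemma sum_blocks: "(\<Sum>i<(N+1)*T. f i) = (\<Sum>j\<le>N. \<Sum>p<T. f (j * T + p))"
  for f :: "nat \<Rightarrow> 'a :: comm_monoid_add"
proof -
  have "sum f {j*T..<j*T+T} = (\<Sum>p<T. f (j*T+p))" for j
    by (subst sum.atLeastLessThan_shift_0) (simp add: lessThan_atLeast0 comp_def)
  then show ?thesis
    unfolding sum.nat_group[symmetric] by (simp add: lessThan_Suc_atMost)
qed

lemma block_less: "j \<le> N \<Longrightarrow> p < T \<Longrightarrow> j * T + p < (N+1) * T" for j N p T :: nat
proof -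
  assume "j \<le> N" "p < T"
  then have "j * T + p < Suc j * T" by simp
  also have "\<dots> \<le> (N+1) * T" using \<open>j \<le> N\<close> by (intro mult_le_mono1) simp
  finally show ?thesis .
qed

lemma integral_block_sum:
  fixes f :: "nat \<Rightarrow> nat \<Rightarrow> real \<Rightarrow> complex"
  assumes "\<And>j p. p < T \<Longrightarrow> integrable lpi (f j p)"
  shows "integrable lpi (\<lambda>x. \<Sum>j\<le>N. \<Sum>p<T. c j p * f j p x)"
    and "(\<integral>x. (\<Sum>j\<le>N. \<Sum>p<T. c j p * f j p x) \<partial>lpi) = (\<Sum>j\<le>N. \<Sum>p<T. c j p * (\<integral>x. f j p x \<partial>lpi))"
proof -
  have i0: "integrable lpi (\<lambda>x. c j p * f j p x)" if "p < T" for j p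
    using assms[OF that] by simp
  then have i: "integrable lpi (\<lambda>x. \<Sum>p<T. c j p * f j p x)" for j
    by (intro Bochner_Integration.integrable_sum) auto
  then show "integrable lpi (\<lambda>x. \<Sum>j\<le>N. \<Sum>p<T. c j p * f j p x)"
    by (rule Bochner_Integration.integrable_sum)
  have "(\<integral>x. (\<Sum>p<T. c j p * f j p x) \<partial>lpi) = (\<Sum>p<T. c j p * (\<integral>x. f j p x \<partial>lpi))" for j
    by (subst Bochner_Integration.integral_sum) (auto intro: i0)
  with i show "(\<integral>x. (\<Sum>j\<le>N. \<Sum>p<T. c j p * f j p x) \<partial>lpi) = (\<Sum>j\<le>N. \<Sum>p<T. c j p * (\<integral>x. f j p x \<partial>lpi))"
    by (subst Bochner_Integration.integral_sum) auto
qed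

text \<open>Pairing with a polynomial of frequencies 0 to \<open>N\<close> sees only those Fourier
  coefficients of \<open>g\<close>. The formula serves twice: it yields the forms of the block
  operators and the orthogonality of \<open>C\<close> to admissible characteristics.\<close>

lemma integral_qform_tvec:
  fixes g :: "real \<Rightarrow> complex vec"
  assumes g: "\<And>x. g x \<in> carrier_vec T" "\<And>p. p < T \<Longrightarrow> integrable lpi (\<lambda>x. g x $ p)"
  shows "integrable lpi (\<lambda>x. qform (g x) (1\<^sub>m T) (tvec T N c x))"
    and "(\<integral>x. qform (g x) (1\<^sub>m T) (tvec T N c x) \<partial>lpi)
      = (\<Sum>j\<le>N. \<Sum>p<T. cnj (c $ (j * T + p)) * (\<integral>x. g x $ p * cnj (emode j x) \<partial>lpi))"
proof -
  have e: "qform (g x) (1\<^sub>m T) (tvec T N c x)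
      = (\<Sum>j\<le>N. \<Sum>p<T. cnj (c $ (j * T + p)) * (g x $ p * cnj (emode j x)))" for x
  proof -
    have "qform (g x) (1\<^sub>m T) (tvec T N c x) = (\<Sum>p<T. g x $ p * cnj (tvec T N c x $ p))"
      using g(1)[of x] tvec_carrier[of T N c x]
      by (simp add: qform_one scalar_prod_def lessThan_atLeast0)
    also have "\<dots> = (\<Sum>p<T. \<Sum>j\<le>N. cnj (c $ (j * T + p)) * (g x $ p * cnj (emode j x)))"
      by (simp add: tvec_def sum_distrib_left mult_ac)
    finally show ?thesis by (subst (asm) sum.swap)
  qed
  show "integrable lpi (\<lambda>x. qform (g x) (1\<^sub>m T) (tvec T N c x))"
    unfolding e by (intro integral_block_sum integrable_emode g)
  show "(\<integral>x. qform (g x) (1\<^sub>m T) (tvec T N c x) \<partial>lpi)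
      = (\<Sum>j\<le>N. \<Sum>p<T. cnj (c $ (j * T + p)) * (\<integral>x. g x $ p * cnj (emode j x) \<partial>lpi))"
    unfolding e by (intro integral_block_sum integrable_emode g)
qed

section \<open>Block operators as compressed multiplication operators\<close>

lemma blockop_carrier: "blockop T N Phi \<in> carrier_mat ((N+1)*T) ((N+1)*T)"
  by (simp add: blockop_def)

text \<open>The matrix is block Toeplitz: it multiplies the polynomial of \<open>d\<close> by the
  transposed symbol and keeps the Fourier coefficients 0 to \<open>N\<close>. In this form a linear
  system for coefficients becomes a statement about vanishing frequencies.\<close>

lemma index_blockop_mult:
  assumes A: "mat_integrable T Phi" and d: "d \<in> carrier_vec ((N+1)*T)" and k: "k \<le> N" and p: "p < T"
  shows "(blockop T N Phi *\<^sub>v d) $ (k * T + p)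
    = 1 / (2 * pi) * (\<integral>x. ((Phi x)\<^sup>T *\<^sub>v tvec T N d x) $ p * cnj (emode k x) \<partial>lpi)"
proof -
  have c: "Phi x \<in> carrier_mat T T" for x using A by (simp add: mat_integrable_def)
  have i: "integrable lpi (\<lambda>x. Phi x $$ (q,p))" if "q < T" for q
    using A p that by (simp add: mat_integrable_def)
  have kp: "k * T + p < (N+1) * T" by (rule block_less[OF k p])
  have ee: "exp (\<i> * (of_nat j - of_nat k) * complex_of_real x) = emode j x * cnj (emode k x)" for j x
    unfolding cnj_emode exp_add[symmetric] by (simp add: algebra_simps)
  have "(blockop T N Phi *\<^sub>v d) $ (k * T + p) = (\<Sum>s<(N+1)*T. blockop T N Phi $$ (k * T + p, s) * d $ s)"
    using kp d by (simp add: blockop_def scalar_prod_def lessThan_atLeast0)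
  also have "\<dots> = (\<Sum>j\<le>N. \<Sum>q<T. blockop T N Phi $$ (k * T + p, j * T + q) * d $ (j * T + q))"
    by (rule sum_blocks)
  also have "\<dots> = (\<Sum>j\<le>N. \<Sum>q<T. 1 / (2 * pi) * (d $ (j * T + q) *
      (\<integral>x. Phi x $$ (q,p) * emode j x * cnj (emode k x) \<partial>lpi)))"
  proof (intro sum.cong refl)
    fix j q assume "j \<in> {..N}" "q \<in> {..<T}"
    then have j: "j \<le> N" and q: "q < T" by auto
    have "blockop T N Phi $$ (k * T + p, j * T + q) = 1 / (2 * pi) *
        (\<integral>x. Phi x $$ (q,p) * exp (\<i> * (of_nat j - of_nat k) * complex_of_real x) \<partial>lpi)"
      using kp block_less[OF j q] p q by (simp add: blockop_def intpi_eq)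
    then show "blockop T N Phi $$ (k * T + p, j * T + q) * d $ (j * T + q) = 1 / (2 * pi) * (d $ (j * T + q) *
      (\<integral>x. Phi x $$ (q,p) * emode j x * cnj (emode k x) \<partial>lpi))"
      unfolding ee by (simp only: mult_ac)
  qed
  also have "\<dots> = 1 / (2 * pi) * (\<Sum>j\<le>N. \<Sum>q<T. d $ (j * T + q) * (\<integral>x. Phi x $$ (q,p) * emode j x * cnj (emode k x) \<partial>lpi))"
    by (simp only: sum_distrib_left)
  also have "(\<Sum>j\<le>N. \<Sum>q<T. d $ (j * T + q) * (\<integral>x. Phi x $$ (q,p) * emode j x * cnj (emode k x) \<partial>lpi))
     = (\<integral>x. (\<Sum>j\<le>N. \<Sum>q<T. d $ (j * T + q) * (Phi x $$ (q,p) * emode j x * cnj (emode k x))) \<partial>lpi)"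
    by (rule integral_block_sum(2)[symmetric]) (intro integrable_emode i)
  finally have *: "(blockop T N Phi *\<^sub>v d) $ (k * T + p) = 1 / (2 * pi) *
    (\<integral>x. (\<Sum>j\<le>N. \<Sum>q<T. d $ (j * T + q) * (Phi x $$ (q,p) * emode j x * cnj (emode k x))) \<partial>lpi)" .
  have "(\<Sum>j\<le>N. \<Sum>q<T. d $ (j * T + q) * (Phi x $$ (q,p) * emode j x * cnj (emode k x)))
     = ((Phi x)\<^sup>T *\<^sub>v tvec T N d x) $ p * cnj (emode k x)" for x
    unfolding index_transpose_mult_vec[OF c tvec_carrier p]
    by (subst sum.swap) (simp add: tvec_def sum_distrib_left sum_distrib_right mult_ac)
  with * show ?thesis by simp
qed

text \<open>Pairing the compressed coefficients with \<open>c\<close> is the same as integrating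
  against the conjugated polynomial of \<open>c\<close>. The factor \<open>cvec c\<close> supplies
  the conjugation, since \<open>scalar_prod\<close> is bilinear.\<close>

lemma blockop_form:
  assumes A: "mat_integrable T Phi" and d: "d \<in> carrier_vec ((N+1)*T)" and c: "c \<in> carrier_vec ((N+1)*T)"
  shows "scalar_prod (cvec c) (blockop T N Phi *\<^sub>v d)
    = 1 / (2 * pi) * (\<integral>x. qform (tvec T N d x) (Phi x) (tvec T N c x) \<partial>lpi)"
proof -
  have cA: "Phi x \<in> carrier_mat T T" for x using A by (simp add: mat_integrable_def)
  have "scalar_prod (cvec c) (blockop T N Phi *\<^sub>v d)
      = (\<Sum>i<(N+1)*T. cnj (c $ i) * (blockop T N Phi *\<^sub>v d) $ i)"
    using c d by (simp add: scalar_prod_def lessThan_atLeast0 blockop_def)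
  also have "\<dots> = (\<Sum>j\<le>N. \<Sum>p<T. cnj (c $ (j*T+p)) * (blockop T N Phi *\<^sub>v d) $ (j*T+p))"
    by (rule sum_blocks)
  also have "\<dots> = 1 / (2 * pi) * (\<Sum>j\<le>N. \<Sum>p<T. cnj (c $ (j*T+p)) *
      (\<integral>x. ((Phi x)\<^sup>T *\<^sub>v tvec T N d x) $ p * cnj (emode j x) \<partial>lpi))"
    using A d by (simp add: index_blockop_mult sum_distrib_left mult_ac)
  also have "\<dots> = 1 / (2 * pi) * (\<integral>x. qform ((Phi x)\<^sup>T *\<^sub>v tvec T N d x) (1\<^sub>m T) (tvec T N c x) \<partial>lpi)"
    by (subst integral_qform_tvec(2))
       (auto intro!: transpose_mult_vec_carrier cA tvec_carrier transpose_tvec_integrable A)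
  finally show ?thesis
    using qform_transpose_left[OF tvec_carrier[of T N d] cA one_carrier_mat tvec_carrier[of T N c]]
      right_mult_one_mat[OF cA] by simp
qed

section \<open>Pointwise identities for a pair of spectral densities\<close>

text \<open>The values of the two densities and of the inverse of their sum at one frequency outside
  the exceptional null set. Arguments that hold almost everywhere interpret it pointwise.\<close>

locale psd_triple =
  fixes n :: nat and F G K :: "complex mat"
  assumes F: "hermitian_psd n F" and G: "hermitian_psd n G" and K: "hermitian_psd n K"
    and HK: "(F + G) * K = 1\<^sub>m n" and KH: "K * (F + G) = 1\<^sub>m n"
begin

lemma H: "hermitian_psd n (F + G)"
  by (rule hermitian_psd_add[OF F G])

lemmas Fc = hermitian_psd_carrier[OF F]
lemmas Gc = hermitian_psd_carrier[OF G]
lemmas Kc = hermitian_psd_carrier[OF K]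
lemmas Hc = hermitian_psd_carrier[OF H]
lemmas FKc = square_mult_carrier[OF Fc Kc]

lemma qform_F_le_H: "v \<in> carrier_vec n \<Longrightarrow> Re (qform v F v) \<le> Re (qform v (F + G) v)"
  using hermitian_psd_nonneg[OF G] by (simp add: qform_add_mid[OF _ Fc Gc])

lemma qform_sandwich:
  assumes "hermitian_psd n B" and u: "u \<in> carrier_vec n" and v: "v \<in> carrier_vec n"
    and A: "hermitian_psd n A"
  shows "qform (A\<^sup>T *\<^sub>v u) B (A\<^sup>T *\<^sub>v v) = qform u (A * B * A) v"
proof -
  note c = hermitian_psd_carrier[OF A] hermitian_psd_carrier[OF assms(1)]
  have "qform (A\<^sup>T *\<^sub>v u) B (A\<^sup>T *\<^sub>v v) = qform u (A * B) (A\<^sup>T *\<^sub>v v)"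
    by (rule qform_transpose_left[OF u c transpose_mult_vec_carrier[OF c(1) v]])
  also have "\<dots> = qform u (A * B * A) v"
    by (rule qform_transpose_right[OF A u square_mult_carrier[OF c] v])
  finally show ?thesis .
qed

text \<open>\<open>K H K = K\<close>, so \<open>K\<^sup>T\<close> carries the form of
  \<open>K\<close> to the form of \<open>H\<close>. The H-norm of the optimal characteristic thereby
  becomes the K-norm of the row A F - C.\<close>

lemma qform_K:
  assumes "u \<in> carrier_vec n" "v \<in> carrier_vec n"
  shows "qform (K\<^sup>T *\<^sub>v u) (F + G) (K\<^sup>T *\<^sub>v v) = qform u K v"
  using qform_sandwich[OF H assms K] Kc by (simp add: KH)

lemma norm_index_K:
  assumes "p < n" "q < n"
  shows "2 * cmod (K $$ (p,q)) \<le> Re (K $$ (p,p)) + Re (K $$ (q,q))"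
  using qform_AMGM[OF K unit_vec_carrier unit_vec_carrier, of p q] assms
  by (simp add: qform_unit_vec[OF Kc])

lemma Re_index_K_nonneg: "p < n \<Longrightarrow> 0 \<le> Re (K $$ (p,p))"
  using hermitian_psd_nonneg[OF K unit_vec_carrier, of p] by (simp add: qform_unit_vec[OF Kc])

lemma norm_index_FK:
  assumes p: "p < n" and q: "q < n"
  shows "2 * cmod ((F * K) $$ (p,q)) \<le> Re (F $$ (p,p)) + Re (K $$ (q,q))"
proof -
  \<comment> \<open>the AM-GM inequality for the form \<open>F\<close>, then \<open>F \<le> H\<close> and \<open>K H K = K\<close>\<close>
  let ?w = "K\<^sup>T *\<^sub>v unit_vec n q"
  have w: "?w \<in> carrier_vec n" by (rule transpose_mult_vec_carrier[OF Kc unit_vec_carrier])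
  have "(F * K) $$ (p,q) = qform (unit_vec n p) F ?w"
    using p q FKc qform_transpose_right[OF K unit_vec_carrier Fc unit_vec_carrier, of p q]
    by (simp add: qform_unit_vec)
  then have "2 * cmod ((F * K) $$ (p,q)) \<le> Re (qform (unit_vec n p) F (unit_vec n p)) + Re (qform ?w F ?w)"
    using qform_AMGM[OF F unit_vec_carrier w, of p] by simp
  moreover have "Re (qform ?w F ?w) \<le> Re (K $$ (q,q))"
    using qform_F_le_H[OF w] q by (simp add: qform_K qform_unit_vec[OF Kc])
  ultimately show ?thesis
    using p by (simp add: qform_unit_vec[OF Fc])
qed

text \<open>AM-GM for \<open>K\<close> at two rows of \<open>F\<close> reduces every entry to
  diagonal ones, and on the diagonal \<open>sandwich_le\<close> removes \<open>K\<close>.\<close>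

lemma norm_index_FKF:
  assumes p: "p < n" and q: "q < n"
  shows "2 * cmod ((F * K * F) $$ (p,q)) \<le> Re (F $$ (p,p)) + Re (F $$ (q,q))"
proof -
  let ?w = "\<lambda>p. F\<^sup>T *\<^sub>v unit_vec n p"
  have w: "?w p \<in> carrier_vec n" for p by (rule transpose_mult_vec_carrier[OF Fc unit_vec_carrier])
  have FKF: "F * K * F \<in> carrier_mat n n" by (rule square_mult_carrier[OF FKc Fc])
  have e: "qform (?w p) K (?w q) = (F * K * F) $$ (p,q)" if "p < n" "q < n" for p q
    using that qform_sandwich[OF K unit_vec_carrier unit_vec_carrier F, of p q]
    by (simp add: qform_unit_vec[OF FKF])
  have b: "Re (qform (?w p) K (?w p)) \<le> Re (F $$ (p,p))" if "p < n" for p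
    using sandwich_le[OF F G K HK unit_vec_carrier, of p] that e
    by (simp add: qform_unit_vec[OF FKF] qform_unit_vec[OF Fc])
  show ?thesis
    using qform_AMGM[OF K w w, of p q] b[OF p] b[OF q] unfolding e[OF p q] by argo
qed

lemma FKG: "F * K * G = F - F * K * F"
proof -
  have "F = F * (K * (F + G))" using Fc by (simp add: KH)
  also have "\<dots> = F * K * (F + G)" by (rule assoc_mult_mat[OF Fc Kc Hc, symmetric])
  also have "\<dots> = F * K * F + F * K * G" by (rule mult_add_distrib_mat[OF FKc Fc Gc])
  finally have *: "F = F * K * F + F * K * G" .
  have c: "F * K * F \<in> carrier_mat n n" "F * K * G \<in> carrier_mat n n"
    by (rule square_mult_carrier[OF FKc Fc] square_mult_carrier[OF FKc Gc])+
  have "A + B - A = B" if "A \<in> carrier_mat n n" "B \<in> carrier_mat n n" for A B :: "complex mat"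
    using that by (intro eq_matI) auto
  then have "F * K * F + F * K * G - F * K * F = F * K * G"
    using c by blast
  with * show ?thesis by metis
qed

text \<open>A null vector of a semidefinite form is orthogonal to everything. Testing
  \<open>v\<close> against the row v H gives v H K v* = v v*, the sum of the squared moduli, which
  is therefore 0.\<close>

lemma K_definite:
  fixes v :: "complex vec"
  assumes v: "v \<in> carrier_vec n" and 0: "qform v K v = 0" and p: "p < n"
  shows "v $ p = 0"
proof -
  have "qform ((F + G)\<^sup>T *\<^sub>v v) K v = 0"
    by (rule qform_degenerate[OF K v transpose_mult_vec_carrier[OF Hc v] 0])
  then have "qform v (1\<^sub>m n) v = 0"
    using qform_transpose_left[OF v Hc Kc v] by (simp add: HK)
  then have "(\<Sum>p<n. v $ p * cnj (v $ p)) = 0"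
    using v by (simp add: qform_one scalar_prod_def lessThan_atLeast0)
  then have "complex_of_real (\<Sum>p<n. (cmod (v $ p))\<^sup>2) = 0"
    unfolding of_real_sum complex_norm_square .
  then have "(\<Sum>p<n. (cmod (v $ p))\<^sup>2) = 0"
    by (simp only: of_real_eq_0_iff)
  then show ?thesis
    using p by (subst (asm) sum_nonneg_eq_0_iff) auto
qed

section \<open>The candidate characteristic at one frequency, for an arbitrary value of
  \<open>c\<close>\<close>

context
  fixes a c :: "complex vec"
  assumes a: "a \<in> carrier_vec n" and c: "c \<in> carrier_vec n"
begin

lemma rF_carrier: "F\<^sup>T *\<^sub>v a - c \<in> carrier_vec n"
  using transpose_mult_vec_carrier[OF Fc a] c by simp

lemma rG_carrier: "G\<^sup>T *\<^sub>v a + c \<in> carrier_vec n"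
  using transpose_mult_vec_carrier[OF Gc a] c by simp

text \<open>\<open>K H = 1\<close> cancels the inverse and leaves the row A F - C. Integrated
  against an admissible \<open>w\<close>, the term with \<open>c\<close> will drop out, which gives
  the normal equation of the projection.\<close>

lemma qform_optimal:
  assumes w: "w \<in> carrier_vec n"
  shows "qform (K\<^sup>T *\<^sub>v (F\<^sup>T *\<^sub>v a - c)) (F + G) w = qform a F w - qform c (1\<^sub>m n) w"
proof -
  have "qform (K\<^sup>T *\<^sub>v (F\<^sup>T *\<^sub>v a - c)) (F + G) w = qform (F\<^sup>T *\<^sub>v a - c) (1\<^sub>m n) w"
    using qform_transpose_left[OF rF_carrier Kc Hc w] by (simp add: KH)
  also have "\<dots> = qform (F\<^sup>T *\<^sub>v a) (1\<^sub>m n) w - qform c (1\<^sub>m n) w"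
    by (rule qform_minus_left[OF transpose_mult_vec_carrier[OF Fc a] c one_carrier_mat w])
  also have "qform (F\<^sup>T *\<^sub>v a) (1\<^sub>m n) w = qform a F w"
    using qform_transpose_left[OF a Fc one_carrier_mat w] Fc by simp
  finally show ?thesis .
qed

text \<open>Expanded so that only the matrices \<open>F K F\<close>, \<open>F K\<close> and
  \<open>K\<close> occur, each of which has integrable entries.\<close>

lemma qform_optimal_self:
  "qform (K\<^sup>T *\<^sub>v (F\<^sup>T *\<^sub>v a - c)) (F + G) (K\<^sup>T *\<^sub>v (F\<^sup>T *\<^sub>v a - c))
   = qform a (F * K * F) a - qform a (F * K) c - cnj (qform a (F * K) c) + qform c K c"
proof -
  let ?u = "F\<^sup>T *\<^sub>v a"
  have u: "?u \<in> carrier_vec n" by (rule transpose_mult_vec_carrier[OF Fc a])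
  have "qform (K\<^sup>T *\<^sub>v (?u - c)) (F + G) (K\<^sup>T *\<^sub>v (?u - c)) = qform (?u - c) K (?u - c)"
    by (rule qform_K[OF rF_carrier rF_carrier])
  also have "\<dots> = qform ?u K ?u - qform ?u K c - qform c K ?u + qform c K c"
    using u c Kc by (simp add: qform_minus_left[of _ n] qform_minus_right[of _ n])
  also have "qform c K ?u = cnj (qform ?u K c)" by (rule qform_swap[OF K u c])
  also have "qform ?u K c = qform a (F * K) c" by (rule qform_transpose_left[OF a Fc Kc c])
  also have "qform ?u K ?u = qform a (F * K * F) a" by (rule qform_sandwich[OF K a a F])
  finally show ?thesis .
qed

text \<open>The rows \<open>r\<^sub>F\<close> and \<open>r\<^sub>G\<close> add up to A H because the
  terms with \<open>c\<close> cancel, and \<open>H K = 1\<close>.\<close>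

lemma optimal_complement: "K\<^sup>T *\<^sub>v (F\<^sup>T *\<^sub>v a - c) = a - K\<^sup>T *\<^sub>v (G\<^sup>T *\<^sub>v a + c)"
proof -
  let ?u = "F\<^sup>T *\<^sub>v a" and ?v = "G\<^sup>T *\<^sub>v a"
  have u: "?u \<in> carrier_vec n" "?v \<in> carrier_vec n"
    by (rule transpose_mult_vec_carrier[OF Fc a] transpose_mult_vec_carrier[OF Gc a])+
  have KT: "K\<^sup>T \<in> carrier_mat n n" using Kc by simp
  have s: "?u + ?v = (F + G)\<^sup>T *\<^sub>v a"
    using Fc Gc a by (simp add: transpose_add add_mult_distrib_mat_vec[of _ n n])
  have "K\<^sup>T *\<^sub>v (?u - c) + K\<^sup>T *\<^sub>v (?v + c) = K\<^sup>T *\<^sub>v (?u - c + (?v + c))"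
    by (rule mult_add_distrib_mat_vec[OF KT rF_carrier rG_carrier, symmetric])
  also have "?u - c + (?v + c) = (F + G)\<^sup>T *\<^sub>v a"
  proof -
    have "x - z + (y + z) = x + y" if "x \<in> carrier_vec n" "y \<in> carrier_vec n" "z \<in> carrier_vec n"
      for x y z :: "complex vec"
      using that by (intro eq_vecI) auto
    with u c show ?thesis unfolding s[symmetric] by blast
  qed
  also have "K\<^sup>T *\<^sub>v ((F + G)\<^sup>T *\<^sub>v a) = ((F + G) * K)\<^sup>T *\<^sub>v a"
    unfolding transpose_mult[OF Hc Kc]
    by (rule assoc_mult_mat_vec[symmetric, OF KT _ a]) (use Hc in simp)
  also have "\<dots> = a" unfolding HK using a by simp
  finally have *: "K\<^sup>T *\<^sub>v (?u - c) + K\<^sup>T *\<^sub>v (?v + c) = a" .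
  have "K\<^sup>T *\<^sub>v (?u - c) \<in> carrier_vec n" "K\<^sup>T *\<^sub>v (?v + c) \<in> carrier_vec n"
    by (rule transpose_mult_vec_carrier[OF Kc rF_carrier] transpose_mult_vec_carrier[OF Kc rG_carrier])+
  then show ?thesis
    by (subst *[symmetric]) (intro eq_vecI; simp)
qed

lemma qform_error_signal:
  "qform (a - K\<^sup>T *\<^sub>v (F\<^sup>T *\<^sub>v a - c)) F (a - K\<^sup>T *\<^sub>v (F\<^sup>T *\<^sub>v a - c))
   = qform (G\<^sup>T *\<^sub>v a + c) (K * F * K) (G\<^sup>T *\<^sub>v a + c)"
proof -
  have "K\<^sup>T *\<^sub>v (G\<^sup>T *\<^sub>v a + c) \<in> carrier_vec n" by (rule transpose_mult_vec_carrier[OF Kc rG_carrier])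
  then have "a - K\<^sup>T *\<^sub>v (F\<^sup>T *\<^sub>v a - c) = K\<^sup>T *\<^sub>v (G\<^sup>T *\<^sub>v a + c)"
    unfolding optimal_complement using a by (intro eq_vecI) auto
  then show ?thesis
    using qform_sandwich[OF F rG_carrier rG_carrier K] by simp
qed

lemma qform_error_noise:
  "qform (K\<^sup>T *\<^sub>v (F\<^sup>T *\<^sub>v a - c)) G (K\<^sup>T *\<^sub>v (F\<^sup>T *\<^sub>v a - c))
   = qform (F\<^sup>T *\<^sub>v a - c) (K * G * K) (F\<^sup>T *\<^sub>v a - c)"
  by (rule qform_sandwich[OF G rF_carrier rF_carrier K])

end

end

section \<open>The projection problem for one pair of spectral densities\<close>

lemma tvec_coefficient:
  assumes "j \<le> N" "p < T"
  shows "(\<integral>x. tvec T N c x $ p * cnj (emode j x) \<partial>lpi) = 2 * pi * c $ (j * T + p)"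
proof -
  have i: "integrable lpi (\<lambda>x. emode k x * cnj (emode j x))" for k
    using finite_measure.integrable_const[OF finite_measure_lpi, of "1::complex"]
      integrable_emode[where f = "\<lambda>_. 1"] by (intro integrable_emode) auto
  have "(\<integral>x. tvec T N c x $ p * cnj (emode j x) \<partial>lpi)
      = (\<integral>x. (\<Sum>k\<le>N. c $ (k * T + p) * (emode k x * cnj (emode j x))) \<partial>lpi)"
    using assms by (simp add: tvec_def sum_distrib_right mult.assoc)
  also have "\<dots> = (\<Sum>k\<le>N. (\<integral>x. c $ (k * T + p) * (emode k x * cnj (emode j x)) \<partial>lpi))"
    by (rule Bochner_Integration.integral_sum) (rule integrable_mult_right[OF i])
  also have "\<dots> = (\<Sum>k\<le>N. c $ (k * T + p) * (\<integral>x. emode k x * cnj (emode j x) \<partial>lpi))"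
    by (simp only: integral_mult_right_zero)
  also have "\<dots> = (\<Sum>k\<le>N. if k = j then 2 * pi * c $ (k * T + p) else 0)"
    unfolding integral_emode_ortho by (intro sum.cong) auto
  finally show ?thesis using assms by simp
qed

lemma Re_integral_qform_nonneg:
  assumes "AE x in lpi. hermitian_psd n (A x)" "\<And>x. v x \<in> carrier_vec n"
  shows "0 \<le> Re (\<integral>x. qform (v x) (A x) (v x) \<partial>lpi)"
proof (cases "integrable lpi (\<lambda>x. qform (v x) (A x) (v x))")
  case True
  have "0 \<le> (\<integral>x. Re (qform (v x) (A x) (v x)) \<partial>lpi)"
    using assms by (intro integral_nonneg_AE) (auto elim!: eventually_mono intro: hermitian_psd_nonneg)
  then show ?thesis using True by (simp add: integral_Re)
\<comment> \<open>A function that is not integrable has integral 0 by convention, so the bound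
  persists.\<close>
qed (simp add: not_integrable_integral_eq)

lemma integral_qform_real:
  assumes "AE x in lpi. hermitian_psd n (A x)" "\<And>x. v x \<in> carrier_vec n"
    "integrable lpi (\<lambda>x. qform (v x) (A x) (v x))"
  shows "(\<integral>x. qform (v x) (A x) (v x) \<partial>lpi)
    = complex_of_real (Re (\<integral>x. qform (v x) (A x) (v x) \<partial>lpi))"
proof -
  have "(\<integral>x. Im (qform (v x) (A x) (v x)) \<partial>lpi) = 0"
  proof (rule integral_eq_zero_AE)
    show "AE x in lpi. Im (qform (v x) (A x) (v x)) = 0"
      using assms(1)
    proof eventually_elim
      case (elim x)
      from arg_cong[OF qform_self_real[OF elim assms(2)], of Im x] show ?case by simp
    qed
  qed
  then show ?thesis using assms(3) by (simp add: complex_eq_iff integral_Im)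
qed

text \<open>The data of one degree in \<open>Mset\<close>, with \<open>K\<close> the inverse of the
  summed density. Integrability of the trace is the minimality condition; that of the single entries
  of \<open>K\<close> is derived from it.\<close>

locale spectral_pair =
  fixes T :: nat and F G K :: "real \<Rightarrow> complex mat"
  assumes F_int: "mat_integrable T F" and G_int: "mat_integrable T G" and K_meas: "mat_measurable T K"
    and triple: "AE x in lpi. psd_triple T (F x) (G x) (K x)"
    and trace_int: "integrable lpi (\<lambda>x. \<Sum>p<T. K x $$ (p,p))"
begin

lemma carriers: "F x \<in> carrier_mat T T" "G x \<in> carrier_mat T T" "K x \<in> carrier_mat T T"
  using F_int G_int K_meas by (simp_all add: mat_integrable_def mat_measurable_def)

lemmas F_meas = mat_integrable_imp_measurable[OF F_int]
lemmas G_meas = mat_integrable_imp_measurable[OF G_int]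
lemmas H_meas = mat_measurable_add[OF F_meas G_meas]

lemma Re_F_int: "p < T \<Longrightarrow> integrable lpi (\<lambda>x. Re (F x $$ (p,p)))"
  using F_int by (auto simp: mat_integrable_def)

text \<open>The diagonal entries are nonnegative, so the trace dominates each of them, and by AM-GM
  it dominates all the other entries too.\<close>

lemma K_int: "mat_integrable T K"
  unfolding mat_integrable_def
proof (intro conjI allI impI carriers)
  fix p q assume pq: "p < T" "q < T"
  show "integrable lpi (\<lambda>x. K x $$ (p,q))"
  proof (rule integrable_dominated[OF integrable_Re[OF trace_int]])
    show "(\<lambda>x. K x $$ (p,q)) \<in> borel_measurable lpi"
      using K_meas pq by (simp add: mat_measurable_def)
    show "AE x in lpi. cmod (K x $$ (p,q)) \<le> Re (\<Sum>p<T. K x $$ (p,p))"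
      using triple
    proof eventually_elim
      case (elim x)
      then interpret psd_triple T "F x" "G x" "K x" .
      have "Re (K x $$ (r,r)) \<le> (\<Sum>p<T. Re (K x $$ (p,p)))" if "r < T" for r
        using that by (intro member_le_sum) (auto simp: Re_index_K_nonneg)
      from this[OF pq(1)] this[OF pq(2)] norm_index_K[OF pq] show ?case
        unfolding Re_sum by argo
    qed
  qed
qed

lemma FK_int: "mat_integrable T (\<lambda>x. F x * K x)"
  unfolding mat_integrable_def
proof (intro conjI allI impI)
  show "F x * K x \<in> carrier_mat T T" for x by (rule square_mult_carrier[OF carriers(1) carriers(3)])
  fix p q assume pq: "p < T" "q < T"
  have "integrable lpi (\<lambda>x. Re (K x $$ (q,q)))"
    using K_int pq by (auto simp: mat_integrable_def)
  then have "integrable lpi (\<lambda>x. (Re (F x $$ (p,p)) + Re (K x $$ (q,q))) / 2)"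
    using Re_F_int[OF pq(1)] by simp
  then show "integrable lpi (\<lambda>x. (F x * K x) $$ (p,q))"
  proof (rule integrable_dominated)
    show "(\<lambda>x. (F x * K x) $$ (p,q)) \<in> borel_measurable lpi"
      using mat_measurable_mult[OF F_meas K_meas] pq by (simp add: mat_measurable_def)
    show "AE x in lpi. cmod ((F x * K x) $$ (p,q)) \<le> (Re (F x $$ (p,p)) + Re (K x $$ (q,q))) / 2"
      using triple
    proof eventually_elim
      case (elim x)
      from psd_triple.norm_index_FK[OF elim pq] show ?case by argo
    qed
  qed
qed

lemma FKF_int: "mat_integrable T (\<lambda>x. F x * K x * F x)"
  unfolding mat_integrable_def
proof (intro conjI allI impI)
  show "F x * K x * F x \<in> carrier_mat T T" for x
    by (intro square_mult_carrier carriers)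
  fix p q assume pq: "p < T" "q < T"
  have "integrable lpi (\<lambda>x. (Re (F x $$ (p,p)) + Re (F x $$ (q,q))) / 2)"
    using Re_F_int[OF pq(1)] Re_F_int[OF pq(2)] by simp
  then show "integrable lpi (\<lambda>x. (F x * K x * F x) $$ (p,q))"
  proof (rule integrable_dominated)
    show "(\<lambda>x. (F x * K x * F x) $$ (p,q)) \<in> borel_measurable lpi"
      using mat_measurable_mult[OF mat_measurable_mult[OF F_meas K_meas] F_meas] pq
      by (simp add: mat_measurable_def)
    show "AE x in lpi. cmod ((F x * K x * F x) $$ (p,q)) \<le> (Re (F x $$ (p,p)) + Re (F x $$ (q,q))) / 2"
      using triple
    proof eventually_elim
      case (elim x)
      from psd_triple.norm_index_FKF[OF elim pq] show ?case by argo
    qed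
  qed
qed

lemma FKG_int: "mat_integrable T (\<lambda>x. F x * K x * G x)"
  unfolding mat_integrable_def
proof (intro conjI allI impI)
  show "F x * K x * G x \<in> carrier_mat T T" for x
    by (intro square_mult_carrier carriers)
  fix p q assume pq: "p < T" "q < T"
  have "integrable lpi (\<lambda>x. F x $$ (p,q) - (F x * K x * F x) $$ (p,q))"
    using F_int FKF_int pq by (auto simp: mat_integrable_def)
  then show "integrable lpi (\<lambda>x. (F x * K x * G x) $$ (p,q))"
  proof (rule integrable_cong_AE_imp)
    show "(\<lambda>x. (F x * K x * G x) $$ (p,q)) \<in> borel_measurable lpi"
      using mat_measurable_mult[OF mat_measurable_mult[OF F_meas K_meas] G_meas] pq
      by (simp add: mat_measurable_def)
    show "AE x in lpi. F x $$ (p,q) - (F x * K x * F x) $$ (p,q) = (F x * K x * G x) $$ (p,q)"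
      using triple
    proof eventually_elim
      case (elim x)
      have "F x * K x * F x \<in> carrier_mat T T" by (intro square_mult_carrier carriers)
      then have "(F x - F x * K x * F x) $$ (p,q) = F x $$ (p,q) - (F x * K x * F x) $$ (p,q)"
        using pq by (intro index_minus_mat(1)) auto
      then show ?case unfolding psd_triple.FKG[OF elim] by simp
    qed
  qed
qed

lemma AE_psd:
  "AE x in lpi. hermitian_psd T (F x)" "AE x in lpi. hermitian_psd T (G x)"
  "AE x in lpi. hermitian_psd T (F x + G x)" "AE x in lpi. hermitian_psd T (K x)"
  using triple by (auto elim!: eventually_mono intro: psd_triple.F psd_triple.G psd_triple.H psd_triple.K)

lemma blockop_K_invertible: "mat_inverse (blockop T N K) \<noteq> None"
proof -
  let ?n = "(N + 1) * T" and ?B = "blockop T N K"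
  note B = blockop_carrier[of T N K]
  have "det ?B \<noteq> 0"
  proof
    assume "det ?B = 0"
    then obtain v where v: "v \<in> carrier_vec ?n" "v \<noteq> 0\<^sub>v ?n" "?B *\<^sub>v v = 0\<^sub>v ?n"
      using det_0_iff_vec_prod_zero_field[OF B] by auto
    let ?V = "tvec T N v"
    have i: "integrable lpi (\<lambda>x. qform (?V x) (K x) (?V x))" by (rule qform_tvec_integrable[OF K_int])
    have "scalar_prod (cvec v) (?B *\<^sub>v v) = 0"
      unfolding v(3) using v(1) by simp
    then have "(\<integral>x. qform (?V x) (K x) (?V x) \<partial>lpi) = 0"
      unfolding blockop_form[OF K_int v(1) v(1)] by simp
    then have 0: "(\<integral>x. Re (qform (?V x) (K x) (?V x)) \<partial>lpi) = 0"
      using i by (simp add: integral_Re)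
    have nn: "AE x in lpi. 0 \<le> Re (qform (?V x) (K x) (?V x))"
      using AE_psd(4) by (auto elim!: eventually_mono intro: hermitian_psd_nonneg tvec_carrier)
    have "AE x in lpi. Re (qform (?V x) (K x) (?V x)) = 0"
      using 0 integral_nonneg_eq_0_iff_AE[OF integrable_Re[OF i] nn] by simp
    then have V0: "AE x in lpi. \<forall>p<T. ?V x $ p = 0"
      using triple
    proof eventually_elim
      case (elim x)
      then interpret psd_triple T "F x" "G x" "K x" by simp
      have "qform (?V x) (K x) (?V x) = 0"
        using qform_self_real[OF K tvec_carrier, of N v x] elim(1) by simp
      then show ?case using K_definite[OF tvec_carrier] by blast
    qed
    \<comment> \<open>The entries of \<open>v\<close> are, up to \<open>2 * pi\<close>, Fourier
      coefficients of \<open>?V\<close>, which vanishes almost everywhere.\<close>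
    have "v $ i = 0" if i: "i < ?n" for i
    proof -
      have T: "T > 0" using i by (cases T) auto
      have j: "i div T \<le> N" using i T by (simp add: less_mult_imp_div_less flip: less_Suc_eq_le)
      have p: "i mod T < T" using T by simp
      have "(\<integral>x. ?V x $ (i mod T) * cnj (emode (i div T) x) \<partial>lpi) = 0"
        using V0 p by (intro integral_eq_zero_AE) (auto elim!: eventually_mono)
      then show ?thesis
        unfolding tvec_coefficient[OF j p] by simp
    qed
    then have "v = 0\<^sub>v ?n" using v(1) by (intro eq_vecI) auto
    with v(2) show False by simp
  qed
  then show ?thesis
    using det_non_zero_imp_unit[OF B, where b = "()"] mat_inverse(1)[OF B, where b = "()"] by blast
qed

end

section \<open>The error functional on admissible characteristics\<close>

context spectral_pair
begin

text \<open>The condition that \<open>L2N\<close> puts on each single component; the summability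
  over the degrees is treated separately.\<close>

definition admissible :: "nat \<Rightarrow> (real \<Rightarrow> complex vec) \<Rightarrow> bool" where
  "admissible N h \<longleftrightarrow> (\<forall>x. h x \<in> carrier_vec T) \<and> (\<forall>p<T. integrable lpi (\<lambda>x. h x $ p))
     \<and> (\<forall>j\<le>N. \<forall>p<T. (\<integral>x. h x $ p * cnj (emode j x) \<partial>lpi) = 0)
     \<and> integrable lpi (\<lambda>x. qform (h x) (F x + G x) (h x))"

definition mse :: "(real \<Rightarrow> complex vec) \<Rightarrow> (real \<Rightarrow> complex vec) \<Rightarrow> real" where
  "mse A h = Re (1 / (2 * pi) * (\<integral>x. qform (A x - h x) (F x) (A x - h x) \<partial>lpi))
     + Re (1 / (2 * pi) * (\<integral>x. qform (h x) (G x) (h x) \<partial>lpi))"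

lemma admissible_carrier: "admissible N h \<Longrightarrow> h x \<in> carrier_vec T"
  by (simp add: admissible_def)

lemma admissible_measurable: "admissible N h \<Longrightarrow> vec_measurable T h"
  by (auto simp: admissible_def vec_measurable_def intro: borel_measurable_integrable)

lemma admissible_H: "admissible N h \<Longrightarrow> integrable lpi (\<lambda>x. qform (h x) (F x + G x) (h x))"
  by (simp add: admissible_def)

lemma qform_split:
  assumes "u \<in> carrier_vec T" "v \<in> carrier_vec T"
  shows "qform u (F x + G x) v = qform u (F x) v + qform u (G x) v"
  by (rule qform_add_mid[OF assms(1) carriers(1,2) assms(2)])

lemma admissible_F:
  assumes h: "admissible N h"
  shows "integrable lpi (\<lambda>x. qform (h x) (F x) (h x))"
proof (rule integrable_dominated[OF integrable_Re[OF admissible_H[OF h]]])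
  note m = admissible_measurable[OF h]
  show "(\<lambda>x. qform (h x) (F x) (h x)) \<in> borel_measurable lpi"
    by (rule qform_measurable[OF m F_meas m])
  show "AE x in lpi. cmod (qform (h x) (F x) (h x)) \<le> Re (qform (h x) (F x + G x) (h x))"
    using triple
  proof eventually_elim
    case (elim x)
    then interpret psd_triple T "F x" "G x" "K x" .
    note c = admissible_carrier[OF h, of x]
    have "cmod (qform (h x) (F x) (h x)) = Re (qform (h x) (F x) (h x))"
      using hermitian_psd_nonneg[OF F c] by (subst qform_self_real[OF F c]) simp
    with qform_F_le_H[OF c] show ?case by simp
  qed
qed

lemma admissible_G:
  assumes h: "admissible N h"
  shows "integrable lpi (\<lambda>x. qform (h x) (G x) (h x))"
proof -
  have "integrable lpi (\<lambda>x. qform (h x) (F x + G x) (h x) - qform (h x) (F x) (h x))"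
    using admissible_H[OF h] admissible_F[OF h] by simp
  then show ?thesis
    using qform_split[OF admissible_carrier[OF h] admissible_carrier[OF h]] by simp
qed

lemma integral_tvec_admissible:
  assumes h: "admissible N h"
  shows "integrable lpi (\<lambda>x. qform (tvec T N c x) (1\<^sub>m T) (h x))"
    "(\<integral>x. qform (tvec T N c x) (1\<^sub>m T) (h x) \<partial>lpi) = 0"
proof -
  have hi: "\<And>p. p < T \<Longrightarrow> integrable lpi (\<lambda>x. h x $ p)"
    using h by (simp add: admissible_def)
  have e: "qform (tvec T N c x) (1\<^sub>m T) (h x) = cnj (qform (h x) (1\<^sub>m T) (tvec T N c x))" for x
    using admissible_carrier[OF h, of x] tvec_carrier[of T N c x]
    by (simp add: qform_one scalar_prod_def mult.commute)
  have i: "integrable lpi (\<lambda>x. qform (h x) (1\<^sub>m T) (tvec T N c x))"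
    by (rule integral_qform_tvec(1)[OF admissible_carrier[OF h] hi])
  then show "integrable lpi (\<lambda>x. qform (tvec T N c x) (1\<^sub>m T) (h x))"
    unfolding e by simp
  have "(\<integral>x. qform (h x) (1\<^sub>m T) (tvec T N c x) \<partial>lpi)
      = (\<Sum>j\<le>N. \<Sum>p<T. cnj (c $ (j * T + p)) * (\<integral>x. h x $ p * cnj (emode j x) \<partial>lpi))"
    by (rule integral_qform_tvec(2)[OF admissible_carrier[OF h] hi])
  also have "\<dots> = 0"
    using h unfolding admissible_def by (intro sum.neutral ballI) (simp add: sum.neutral)
  finally have "(\<integral>x. qform (h x) (1\<^sub>m T) (tvec T N c x) \<partial>lpi) = 0" .
  then show "(\<integral>x. qform (tvec T N c x) (1\<^sub>m T) (h x) \<partial>lpi) = 0"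
    unfolding e by simp
qed

context
  fixes N :: nat and a :: "complex vec"
  assumes a: "a \<in> carrier_vec ((N+1) * T)"
begin

abbreviation A where "A \<equiv> tvec T N a"

lemma A_int: "integrable lpi (\<lambda>x. qform (A x) (F x) (A x))"
  by (rule qform_tvec_integrable[OF F_int])

lemma A_admissible_int:
  assumes h: "admissible N h"
  shows "integrable lpi (\<lambda>x. qform (A x) (F x) (h x))"
  by (rule qform_integrable_AMGM[OF tvec_measurable F_meas admissible_measurable[OF h] AE_psd(1) A_int
        admissible_F[OF h]])

lemma error_expand:
  assumes h: "admissible N h"
  shows "AE x in lpi. qform (A x - h x) (F x) (A x - h x)
    = qform (A x) (F x) (A x) - qform (A x) (F x) (h x) - cnj (qform (A x) (F x) (h x))
      + qform (h x) (F x) (h x)"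
  using AE_psd(1)
proof eventually_elim
  case (elim x)
  note c = admissible_carrier[OF h, of x] tvec_carrier[of T N a x] carriers(1)[of x]
  show ?case
    using c by (simp add: qform_minus_left[of _ T] qform_minus_right[of _ T] qform_swap[OF elim c(2,1)])
qed

lemma error_int:
  assumes h: "admissible N h"
  shows "integrable lpi (\<lambda>x. qform (A x - h x) (F x) (A x - h x))"
proof -
  note m = vec_measurable_minus[OF tvec_measurable[of T N a] admissible_measurable[OF h]]
  have "integrable lpi (\<lambda>x. qform (A x) (F x) (A x) - qform (A x) (F x) (h x)
      - cnj (qform (A x) (F x) (h x)) + qform (h x) (F x) (h x))"
    using A_int A_admissible_int[OF h] admissible_F[OF h]
    by (intro Bochner_Integration.integrable_add Bochner_Integration.integrable_diff integrable_cnj)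
  then show ?thesis
    by (rule integrable_cong_AE_imp[OF _ qform_measurable[OF m F_meas m]])
       (use error_expand[OF h] in \<open>auto elim: eventually_mono\<close>)
qed

text \<open>The form of \<open>F\<close> at \<open>h\<close> from the signal error and the form of
  \<open>G\<close> at \<open>h\<close> from the noise add up to the form of \<open>H\<close>. The
  only remaining dependence on \<open>h\<close> is the cross term with \<open>A\<close>.\<close>

lemma mse_expand:
  assumes h: "admissible N h"
  shows "2 * pi * mse A h = Re (\<integral>x. qform (A x) (F x) (A x) \<partial>lpi)
    - 2 * Re (\<integral>x. qform (A x) (F x) (h x) \<partial>lpi) + Re (\<integral>x. qform (h x) (F x + G x) (h x) \<partial>lpi)"
proof -
  note i = A_int A_admissible_int[OF h] admissible_F[OF h] admissible_G[OF h]
  have "(\<integral>x. qform (A x - h x) (F x) (A x - h x) \<partial>lpi)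
      = (\<integral>x. qform (A x) (F x) (A x) - qform (A x) (F x) (h x)
      - cnj (qform (A x) (F x) (h x)) + qform (h x) (F x) (h x) \<partial>lpi)"
    using i error_int[OF h] error_expand[OF h]
    by (intro integral_cong_AE borel_measurable_integrable Bochner_Integration.integrable_add
       Bochner_Integration.integrable_diff integrable_cnj)
  also have "\<dots> = (\<integral>x. qform (A x) (F x) (A x) \<partial>lpi) - (\<integral>x. qform (A x) (F x) (h x) \<partial>lpi)
      - cnj (\<integral>x. qform (A x) (F x) (h x) \<partial>lpi) + (\<integral>x. qform (h x) (F x) (h x) \<partial>lpi)"
    using i by simp
  finally have 1: "Re (\<integral>x. qform (A x - h x) (F x) (A x - h x) \<partial>lpi) =
      Re (\<integral>x. qform (A x) (F x) (A x) \<partial>lpi) - 2 * Re (\<integral>x. qform (A x) (F x) (h x) \<partial>lpi)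
      + Re (\<integral>x. qform (h x) (F x) (h x) \<partial>lpi)" by simp
  have 2: "(\<integral>x. qform (h x) (F x + G x) (h x) \<partial>lpi)
      = (\<integral>x. qform (h x) (F x) (h x) \<partial>lpi) + (\<integral>x. qform (h x) (G x) (h x) \<partial>lpi)"
    using i qform_split[OF admissible_carrier[OF h] admissible_carrier[OF h]] by simp
  have "2 * pi * mse A h = Re (\<integral>x. qform (A x - h x) (F x) (A x - h x) \<partial>lpi) + Re (\<integral>x. qform (h x) (G x) (h x) \<partial>lpi)"
    unfolding mse_def Re_scale_two_pi by (simp add: field_simps)
  then show ?thesis unfolding 1 2 by simp
qed

lemma mse_nonneg:
  assumes h: "admissible N h"
  shows "0 \<le> mse A h"
proof -
  have c: "A x - h x \<in> carrier_vec T" "h x \<in> carrier_vec T" for x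
    using admissible_carrier[OF h, of x] tvec_carrier[of T N a x] by simp_all
  show ?thesis
    unfolding mse_def Re_scale_two_pi using Re_integral_qform_nonneg[of T F "\<lambda>x. A x - h x", OF AE_psd(1) c(1)]
      Re_integral_qform_nonneg[of T G h, OF AE_psd(2) c(2)] by simp
qed

text \<open>Makes the error series converge for every characteristic in \<open>L2N\<close>. AM-GM
  absorbs the cross term at the price of doubling the two norms, which turns
  \<open>1 / (2 * pi)\<close> into \<open>1 / pi\<close>.\<close>

lemma mse_le:
  assumes h: "admissible N h"
  shows "mse A h \<le> (Re (\<integral>x. qform (A x) (F x) (A x) \<partial>lpi) + Re (\<integral>x. qform (h x) (F x + G x) (h x) \<partial>lpi)) / pi"
proof -
  note i = A_int A_admissible_int[OF h] admissible_F[OF h] admissible_G[OF h]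
  have "AE x in lpi. 2 * cmod (qform (A x) (F x) (h x)) \<le>
    Re (qform (A x) (F x) (A x)) + Re (qform (h x) (F x + G x) (h x))"
    using triple
  proof eventually_elim
    case (elim x)
    then interpret psd_triple T "F x" "G x" "K x" .
    note c = admissible_carrier[OF h, of x] tvec_carrier[of T N a x]
    from qform_AMGM[OF F c(2,1)] qform_F_le_H[OF c(1)] show ?case by argo
  qed
  then have "AE x in lpi. - 2 * Re (qform (A x) (F x) (h x)) \<le>
    Re (qform (A x) (F x) (A x)) + Re (qform (h x) (F x + G x) (h x))"
  proof eventually_elim
    case (elim x)
    then show ?case using abs_Re_le_cmod[of "qform (A x) (F x) (h x)"] by (simp add: abs_le_iff)
  qed
  then have "(\<integral>x. - 2 * Re (qform (A x) (F x) (h x)) \<partial>lpi) \<le>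
    (\<integral>x. Re (qform (A x) (F x) (A x)) + Re (qform (h x) (F x + G x) (h x)) \<partial>lpi)"
    using i admissible_H[OF h] by (intro integral_mono_AE) simp_all
  then have "- 2 * Re (\<integral>x. qform (A x) (F x) (h x) \<partial>lpi)
     \<le> Re (\<integral>x. qform (A x) (F x) (A x) \<partial>lpi) + Re (\<integral>x. qform (h x) (F x + G x) (h x) \<partial>lpi)"
    using i admissible_H[OF h] by (simp add: integral_Re)
  then have "2 * pi * mse A h \<le> 2 * (Re (\<integral>x. qform (A x) (F x) (A x) \<partial>lpi) + Re (\<integral>x. qform (h x) (F x + G x) (h x) \<partial>lpi))"
    unfolding mse_expand[OF h] by argo
  then show ?thesis by (simp add: field_simps)
qed

section \<open>The optimal characteristic\<close>

definition opt_coeffs :: "complex vec" where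
  "opt_coeffs = minv (blockop T N K) *\<^sub>v (blockop T N (\<lambda>x. F x * K x) *\<^sub>v a)"

abbreviation C where "C \<equiv> tvec T N opt_coeffs"

definition opt :: "real \<Rightarrow> complex vec" where
  "opt x = (K x)\<^sup>T *\<^sub>v ((F x)\<^sup>T *\<^sub>v A x - C x)"

lemma opt_coeffs_carrier: "opt_coeffs \<in> carrier_vec ((N+1) * T)"
  unfolding opt_coeffs_def
  by (intro mult_mat_vec_carrier[OF minv_carrier] mult_mat_vec_carrier[OF blockop_carrier] blockop_carrier a)

lemma normal_equation: "blockop T N K *\<^sub>v opt_coeffs = blockop T N (\<lambda>x. F x * K x) *\<^sub>v a"
proof -
  note B = blockop_carrier[of T N K]
  have y: "blockop T N (\<lambda>x. F x * K x) *\<^sub>v a \<in> carrier_vec ((N+1) * T)"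
    by (intro mult_mat_vec_carrier[OF blockop_carrier] a)
  show ?thesis
    unfolding opt_coeffs_def assoc_mult_mat_vec[OF B minv_carrier[OF B] y, symmetric]
      minv_inverse(1)[OF B blockop_K_invertible]
    using y by simp
qed

lemma rF_carrier: "(F x)\<^sup>T *\<^sub>v A x - C x \<in> carrier_vec T"
  using transpose_mult_vec_carrier[OF carriers(1) tvec_carrier, of x N a x] tvec_carrier[of T N opt_coeffs x]
  by simp

lemma opt_carrier: "opt x \<in> carrier_vec T"
  unfolding opt_def by (rule transpose_mult_vec_carrier[OF carriers(3) rF_carrier])

text \<open>Regrouped into \<open>F K\<close> applied to \<open>A\<close> and \<open>K\<close>
  applied to \<open>C\<close>: both products have integrable entries, and they are the symbols of
  the two block operators in the normal equation.\<close>

lemma opt_index: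
  assumes p: "p < T"
  shows "opt x $ p = ((F x * K x)\<^sup>T *\<^sub>v A x) $ p - ((K x)\<^sup>T *\<^sub>v C x) $ p"
proof -
  have KT: "(K x)\<^sup>T \<in> carrier_mat T T" "(F x)\<^sup>T \<in> carrier_mat T T" using carriers by simp_all
  have "opt x = (K x)\<^sup>T *\<^sub>v ((F x)\<^sup>T *\<^sub>v A x) - (K x)\<^sup>T *\<^sub>v C x"
    unfolding opt_def
    by (rule mult_minus_distrib_mat_vec[OF KT(1) transpose_mult_vec_carrier[OF carriers(1) tvec_carrier] tvec_carrier])
  also have "(K x)\<^sup>T *\<^sub>v ((F x)\<^sup>T *\<^sub>v A x) = (F x * K x)\<^sup>T *\<^sub>v A x"
    unfolding transpose_mult[OF carriers(1,3)]
    by (rule assoc_mult_mat_vec[OF KT tvec_carrier, symmetric])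
  finally have *: "opt x = (F x * K x)\<^sup>T *\<^sub>v A x - (K x)\<^sup>T *\<^sub>v C x" .
  have "dim_vec ((K x)\<^sup>T *\<^sub>v C x) = T" using carriers(3)[of x] by simp
  then show ?thesis
    unfolding * using p by (intro index_minus_vec(1)) simp
qed

lemma opt_measurable: "vec_measurable T opt"
proof -
  have "vec_measurable T (\<lambda>x. (K x)\<^sup>T *\<^sub>v ((F x)\<^sup>T *\<^sub>v A x - C x))"
    by (intro vec_measurable_transpose_mult vec_measurable_minus tvec_measurable K_meas F_meas)
  then show ?thesis unfolding opt_def[abs_def] .
qed

lemma opt_self:
  "AE x in lpi. qform (opt x) (F x + G x) (opt x) = qform (A x) (F x * K x * F x) (A x)
     - qform (A x) (F x * K x) (C x) - cnj (qform (A x) (F x * K x) (C x)) + qform (C x) (K x) (C x)"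
  using triple
proof eventually_elim
  case (elim x)
  then interpret psd_triple T "F x" "G x" "K x" .
  show ?case unfolding opt_def by (rule qform_optimal_self[OF tvec_carrier tvec_carrier])
qed

lemma opt_self_ints:
  "integrable lpi (\<lambda>x. qform (A x) (F x * K x * F x) (A x))"
  "integrable lpi (\<lambda>x. qform (A x) (F x * K x) (C x))"
  "integrable lpi (\<lambda>x. qform (C x) (K x) (C x))"
  "integrable lpi (\<lambda>x. qform (opt x) (F x + G x) (opt x))"
proof -
  show i: "integrable lpi (\<lambda>x. qform (A x) (F x * K x * F x) (A x))"
    "integrable lpi (\<lambda>x. qform (A x) (F x * K x) (C x))"
    "integrable lpi (\<lambda>x. qform (C x) (K x) (C x))"
    by (intro qform_tvec_integrable FKF_int FK_int K_int)+
  then have "integrable lpi (\<lambda>x. qform (A x) (F x * K x * F x) (A x)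
     - qform (A x) (F x * K x) (C x) - cnj (qform (A x) (F x * K x) (C x)) + qform (C x) (K x) (C x))"
    by (intro Bochner_Integration.integrable_add Bochner_Integration.integrable_diff integrable_cnj)
  then show "integrable lpi (\<lambda>x. qform (opt x) (F x + G x) (opt x))"
    by (rule integrable_cong_AE_imp[OF _ qform_measurable[OF opt_measurable H_meas opt_measurable]])
       (use opt_self in \<open>auto elim: eventually_mono\<close>)
qed

lemma opt_admissible: "admissible N opt"
  unfolding admissible_def
proof (intro conjI allI impI opt_carrier opt_self_ints)
  fix p assume p: "p < T"
  show "integrable lpi (\<lambda>x. opt x $ p)"
    unfolding opt_index[OF p]
    by (intro Bochner_Integration.integrable_diff transpose_tvec_integrable FK_int K_int p)
next
  fix j p assume j: "j \<le> N" and p: "p < T"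
  have i: "integrable lpi (\<lambda>x. ((F x * K x)\<^sup>T *\<^sub>v A x) $ p * cnj (emode j x))"
    "integrable lpi (\<lambda>x. ((K x)\<^sup>T *\<^sub>v C x) $ p * cnj (emode j x))"
    by (intro integrable_emode transpose_tvec_integrable FK_int K_int p)+
  have "(\<integral>x. opt x $ p * cnj (emode j x) \<partial>lpi)
    = (\<integral>x. ((F x * K x)\<^sup>T *\<^sub>v A x) $ p * cnj (emode j x) \<partial>lpi) - (\<integral>x. ((K x)\<^sup>T *\<^sub>v C x) $ p * cnj (emode j x) \<partial>lpi)"
    unfolding opt_index[OF p] left_diff_distrib by (rule Bochner_Integration.integral_diff[OF i])
  also have "\<dots> = 2 * pi * (blockop T N (\<lambda>x. F x * K x) *\<^sub>v a) $ (j * T + p)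
      - 2 * pi * (blockop T N K *\<^sub>v opt_coeffs) $ (j * T + p)"
    unfolding index_blockop_mult[OF FK_int a j p] index_blockop_mult[OF K_int opt_coeffs_carrier j p]
    by simp
  also have "\<dots> = 0" unfolding normal_equation by simp
  finally show "(\<integral>x. opt x $ p * cnj (emode j x) \<partial>lpi) = 0" .
qed

lemma integral_opt_admissible:
  assumes h: "admissible N h"
  shows "integrable lpi (\<lambda>x. qform (opt x) (F x + G x) (h x))"
    and "(\<integral>x. qform (opt x) (F x + G x) (h x) \<partial>lpi) = (\<integral>x. qform (A x) (F x) (h x) \<partial>lpi)"
proof -
  show i: "integrable lpi (\<lambda>x. qform (opt x) (F x + G x) (h x))"
    by (rule qform_integrable_AMGM[OF opt_measurable H_meas admissible_measurable[OF h] AE_psd(3)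
        opt_self_ints(4) admissible_H[OF h]])
  note j = integral_tvec_admissible(1)[OF h, of opt_coeffs]
  have "(\<integral>x. qform (opt x) (F x + G x) (h x) \<partial>lpi)
      = (\<integral>x. qform (A x) (F x) (h x) - qform (C x) (1\<^sub>m T) (h x) \<partial>lpi)"
  proof (rule integral_cong_AE)
    show "AE x in lpi. qform (opt x) (F x + G x) (h x) = qform (A x) (F x) (h x) - qform (C x) (1\<^sub>m T) (h x)"
      using triple
    proof eventually_elim
      case (elim x)
      then interpret psd_triple T "F x" "G x" "K x" .
      show ?case unfolding opt_def
        by (rule qform_optimal[OF tvec_carrier tvec_carrier admissible_carrier[OF h]])
    qed
  qed (use i j A_admissible_int[OF h] in \<open>auto intro: borel_measurable_integrable\<close>)
  also have "\<dots> = (\<integral>x. qform (A x) (F x) (h x) \<partial>lpi)"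
    using j A_admissible_int[OF h] integral_tvec_admissible(2)[OF h, of opt_coeffs] by simp
  finally show "(\<integral>x. qform (opt x) (F x + G x) (h x) \<partial>lpi) = (\<integral>x. qform (A x) (F x) (h x) \<partial>lpi)" .
qed

text \<open>With \<open>opt\<close> itself as the test function, orthogonality identifies the cross
  term of \<open>mse_expand\<close> with the squared H-norm of \<open>opt\<close>, which then occurs
  with the factor -2 + 1.\<close>

lemma mse_opt:
  "2 * pi * mse A opt = Re (\<integral>x. qform (A x) (F x) (A x) \<partial>lpi) - Re (\<integral>x. qform (opt x) (F x + G x) (opt x) \<partial>lpi)"
  unfolding mse_expand[OF opt_admissible] integral_opt_admissible(2)[OF opt_admissible, symmetric] by simp

text \<open>By orthogonality the difference of the two sides is \<open>2 * pi\<close> times the error of \<open>opt\<close>. This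
  bound is what makes the squared norms of the optimal characteristics summable over the degrees.\<close>

lemma opt_norm_le:
  "Re (\<integral>x. qform (opt x) (F x + G x) (opt x) \<partial>lpi) \<le> Re (\<integral>x. qform (A x) (F x) (A x) \<partial>lpi)"
proof -
  have "0 \<le> 2 * pi * mse A opt" using mse_nonneg[OF opt_admissible] by simp
  then show ?thesis unfolding mse_opt by simp
qed

text \<open>By orthogonality \<open>2 * pi\<close> times the difference of the errors is exactly the
  squared H-norm of \<open>opt - h\<close>.\<close>

lemma mse_opt_le:
  assumes h: "admissible N h"
  shows "mse A opt \<le> mse A h"
proof -
  note i = integral_opt_admissible(1)[OF h] admissible_H[OF h] opt_self_ints(4)
  have c: "opt x - h x \<in> carrier_vec T" for x
    using opt_carrier[of x] admissible_carrier[OF h, of x] by simp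
  note m = vec_measurable_minus[OF opt_measurable admissible_measurable[OF h]]
  have "(\<integral>x. qform (opt x - h x) (F x + G x) (opt x - h x) \<partial>lpi)
     = (\<integral>x. qform (opt x) (F x + G x) (opt x) - qform (opt x) (F x + G x) (h x)
         - cnj (qform (opt x) (F x + G x) (h x)) + qform (h x) (F x + G x) (h x) \<partial>lpi)"
  proof (rule integral_cong_AE)
    show "AE x in lpi. qform (opt x - h x) (F x + G x) (opt x - h x)
      = qform (opt x) (F x + G x) (opt x) - qform (opt x) (F x + G x) (h x)
         - cnj (qform (opt x) (F x + G x) (h x)) + qform (h x) (F x + G x) (h x)"
      using AE_psd(3)
    proof eventually_elim
      case (elim x)
      note c = opt_carrier[of x] admissible_carrier[OF h, of x] hermitian_psd_carrier[OF elim]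
      show ?case
        using c by (simp add: qform_minus_left[of _ T] qform_minus_right[of _ T] qform_swap[OF elim c(1,2)])
    qed
    show "(\<lambda>x. qform (opt x - h x) (F x + G x) (opt x - h x)) \<in> borel_measurable lpi"
      by (rule qform_measurable[OF m H_meas m])
    show "(\<lambda>x. qform (opt x) (F x + G x) (opt x) - qform (opt x) (F x + G x) (h x)
         - cnj (qform (opt x) (F x + G x) (h x)) + qform (h x) (F x + G x) (h x)) \<in> borel_measurable lpi"
      using i by (intro borel_measurable_integrable Bochner_Integration.integrable_add
       Bochner_Integration.integrable_diff integrable_cnj)
  qed
  also have "\<dots> = (\<integral>x. qform (opt x) (F x + G x) (opt x) \<partial>lpi) - (\<integral>x. qform (opt x) (F x + G x) (h x) \<partial>lpi)
         - cnj (\<integral>x. qform (opt x) (F x + G x) (h x) \<partial>lpi) + (\<integral>x. qform (h x) (F x + G x) (h x) \<partial>lpi)"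
    using i by simp
  finally have "Re (\<integral>x. qform (opt x - h x) (F x + G x) (opt x - h x) \<partial>lpi)
     = Re (\<integral>x. qform (opt x) (F x + G x) (opt x) \<partial>lpi) - 2 * Re (\<integral>x. qform (A x) (F x) (h x) \<partial>lpi)
       + Re (\<integral>x. qform (h x) (F x + G x) (h x) \<partial>lpi)"
    unfolding integral_opt_admissible(2)[OF h] by simp
  then have "2 * pi * mse A opt \<le> 2 * pi * mse A h"
    using Re_integral_qform_nonneg[of T "\<lambda>x. F x + G x" "\<lambda>x. opt x - h x", OF AE_psd(3) c]
    unfolding mse_opt mse_expand[OF h] by argo
  then show ?thesis by simp
qed

section \<open>The two formulas for the least error\<close>

lemma mse_opt_spectral:
  "complex_of_real (mse A opt) = 1 / (2 * pi) * (\<integral>x.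
     qform ((G x)\<^sup>T *\<^sub>v A x + C x) (K x * F x * K x) ((G x)\<^sup>T *\<^sub>v A x + C x)
   + qform ((F x)\<^sup>T *\<^sub>v A x - C x) (K x * G x * K x) ((F x)\<^sup>T *\<^sub>v A x - C x) \<partial>lpi)"
proof -
  note i = error_int[OF opt_admissible] admissible_G[OF opt_admissible]
  have c: "A x - opt x \<in> carrier_vec T" for x
    using opt_carrier[of x] tvec_carrier[of T N a x] by simp
  have rG: "vec_measurable T (\<lambda>x. (G x)\<^sup>T *\<^sub>v A x + C x)"
    unfolding vec_measurable_def
  proof (intro conjI allI impI)
    show "(G x)\<^sup>T *\<^sub>v A x + C x \<in> carrier_vec T" for x
      using transpose_mult_vec_carrier[OF carriers(2) tvec_carrier, of x N a x] tvec_carrier[of T N opt_coeffs x] by simp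
    fix p assume p: "p < T"
    have "((G x)\<^sup>T *\<^sub>v A x + C x) $ p = ((G x)\<^sup>T *\<^sub>v A x) $ p + C x $ p" for x
      using p tvec_carrier[of T N opt_coeffs x] by simp
    then show "(\<lambda>x. ((G x)\<^sup>T *\<^sub>v A x + C x) $ p) \<in> borel_measurable lpi"
      using p vec_measurable_transpose_mult[OF G_meas tvec_measurable, of N a] tvec_measurable[of T N opt_coeffs]
      by (auto simp: vec_measurable_def intro!: borel_measurable_add)
  qed
  have rF: "vec_measurable T (\<lambda>x. (F x)\<^sup>T *\<^sub>v A x - C x)"
    by (intro vec_measurable_minus vec_measurable_transpose_mult F_meas tvec_measurable)
  let ?S = "\<integral>x. qform (A x - opt x) (F x) (A x - opt x) \<partial>lpi"
  let ?Q = "\<integral>x. qform (opt x) (G x) (opt x) \<partial>lpi"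
  have "complex_of_real (mse A opt) = 1 / (2 * pi) * (complex_of_real (Re ?S) + complex_of_real (Re ?Q))"
    unfolding mse_def Re_scale_two_pi by (simp add: field_simps)
  \<comment> \<open>\<open>mse\<close> takes real parts, but Hermitian forms are real almost
    everywhere, so the complex integrals themselves may be used.\<close>
  also have "complex_of_real (Re ?S) = ?S"
    by (rule integral_qform_real[of T F "\<lambda>x. A x - opt x", OF AE_psd(1) c i(1), symmetric])
  also have "complex_of_real (Re ?Q) = ?Q"
    by (rule integral_qform_real[of T G opt, OF AE_psd(2) opt_carrier i(2), symmetric])
  also have "(\<integral>x. qform (A x - opt x) (F x) (A x - opt x) \<partial>lpi) + (\<integral>x. qform (opt x) (G x) (opt x) \<partial>lpi)
    = (\<integral>x. qform (A x - opt x) (F x) (A x - opt x) + qform (opt x) (G x) (opt x) \<partial>lpi)"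
    using i by simp
  also have "\<dots> = (\<integral>x. qform ((G x)\<^sup>T *\<^sub>v A x + C x) (K x * F x * K x) ((G x)\<^sup>T *\<^sub>v A x + C x)
   + qform ((F x)\<^sup>T *\<^sub>v A x - C x) (K x * G x * K x) ((F x)\<^sup>T *\<^sub>v A x - C x) \<partial>lpi)"
  proof (rule integral_cong_AE)
    show "AE x in lpi. qform (A x - opt x) (F x) (A x - opt x) + qform (opt x) (G x) (opt x)
      = qform ((G x)\<^sup>T *\<^sub>v A x + C x) (K x * F x * K x) ((G x)\<^sup>T *\<^sub>v A x + C x)
      + qform ((F x)\<^sup>T *\<^sub>v A x - C x) (K x * G x * K x) ((F x)\<^sup>T *\<^sub>v A x - C x)"
      using triple
    proof eventually_elim
      case (elim x)
      then interpret psd_triple T "F x" "G x" "K x" .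
      show ?case
        unfolding opt_def qform_error_signal[OF tvec_carrier tvec_carrier]
          qform_error_noise[OF tvec_carrier tvec_carrier] ..
    qed
    show "(\<lambda>x. qform (A x - opt x) (F x) (A x - opt x) + qform (opt x) (G x) (opt x)) \<in> borel_measurable lpi"
      using i by (intro borel_measurable_integrable Bochner_Integration.integrable_add)
    show "(\<lambda>x. qform ((G x)\<^sup>T *\<^sub>v A x + C x) (K x * F x * K x) ((G x)\<^sup>T *\<^sub>v A x + C x)
      + qform ((F x)\<^sup>T *\<^sub>v A x - C x) (K x * G x * K x) ((F x)\<^sup>T *\<^sub>v A x - C x)) \<in> borel_measurable lpi"
      by (intro borel_measurable_add qform_measurable[where n = T] rF rG mat_measurable_mult K_meas F_meas G_meas)
  qed
  finally show ?thesis .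
qed

lemma mse_opt_operator:
  "complex_of_real (mse A opt) = scalar_prod (cvec opt_coeffs) (blockop T N K *\<^sub>v opt_coeffs)
     + scalar_prod (cvec a) (blockop T N (\<lambda>x. F x * K x * G x) *\<^sub>v a)"
proof -
  let ?I = "\<lambda>f. integral\<^sup>L lpi f"
  let ?AFA = "?I (\<lambda>x. qform (A x) (F x) (A x))" and ?oo = "?I (\<lambda>x. qform (opt x) (F x + G x) (opt x))"
  let ?S = "?I (\<lambda>x. qform (A x) (F x * K x * F x) (A x))" and ?X = "?I (\<lambda>x. qform (A x) (F x * K x) (C x))"
  let ?CC = "?I (\<lambda>x. qform (C x) (K x) (C x))" and ?R = "?I (\<lambda>x. qform (A x) (F x * K x * G x) (A x))"
  note c = opt_coeffs_carrier
  note i = opt_self_ints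
  \<comment> \<open>The normal equation paired with \<open>opt_coeffs\<close>: its left side is the
    form of \<open>K\<close> at \<open>C\<close>, its right side the cross term of \<open>A\<close>
    and \<open>C\<close>.\<close>
  have X: "?X = ?CC"
    using arg_cong[OF normal_equation, of "\<lambda>v. scalar_prod (cvec opt_coeffs) v"]
    unfolding blockop_form[OF K_int c c] blockop_form[OF FK_int a c] by simp
  have CC: "cnj ?CC = ?CC"
    using integral_qform_real[of T K C, OF AE_psd(4) tvec_carrier i(3)] by (metis complex_cnj_complex_of_real)
  have "?oo = ?I (\<lambda>x. qform (A x) (F x * K x * F x) (A x)
     - qform (A x) (F x * K x) (C x) - cnj (qform (A x) (F x * K x) (C x)) + qform (C x) (K x) (C x))"
    using i by (intro integral_cong_AE[OF _ _ opt_self] borel_measurable_integrable Bochner_Integration.integrable_add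
       Bochner_Integration.integrable_diff integrable_cnj)
  also have "\<dots> = ?S - ?X - cnj ?X + ?CC" using i(1-3) by simp
  \<comment> \<open>Both cross terms equal the real number \<open>?CC\<close>, so two negative
    copies and one positive copy leave \<open>- ?CC\<close>.\<close>
  finally have oo: "?oo = ?S - ?CC" unfolding X CC by simp
  have "?R = ?I (\<lambda>x. qform (A x) (F x) (A x) - qform (A x) (F x * K x * F x) (A x))"
  proof (rule integral_cong_AE)
    show "AE x in lpi. qform (A x) (F x * K x * G x) (A x)
        = qform (A x) (F x) (A x) - qform (A x) (F x * K x * F x) (A x)"
      using triple
    proof eventually_elim
      case (elim x)
      show ?case unfolding psd_triple.FKG[OF elim]
        by (rule qform_minus_mid[OF tvec_carrier carriers(1) _ tvec_carrier])
           (intro square_mult_carrier carriers)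
    qed
    show "(\<lambda>x. qform (A x) (F x * K x * G x) (A x)) \<in> borel_measurable lpi"
      by (intro borel_measurable_integrable qform_tvec_integrable FKG_int)
  qed (intro borel_measurable_integrable Bochner_Integration.integrable_diff A_int i)
  also have "\<dots> = ?AFA - ?S" using A_int i(1) by simp
  finally have R: "?R = ?AFA - ?S" .
  have "2 * complex_of_real pi * complex_of_real (mse A opt) = complex_of_real (2 * pi * mse A opt)" by simp
  also have "\<dots> = ?AFA - ?oo"
    unfolding mse_opt of_real_diff integral_qform_real[of T F A, OF AE_psd(1) tvec_carrier A_int, symmetric]
      integral_qform_real[of T "\<lambda>x. F x + G x" opt, OF AE_psd(3) opt_carrier i(4), symmetric] ..
  also have "\<dots> = ?CC + ?R" unfolding oo R by simp
  finally have "complex_of_real (mse A opt) = 1 / (2 * pi) * ?CC + 1 / (2 * pi) * ?R"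
    by (simp add: field_simps)
  then show ?thesis
    unfolding blockop_form[OF K_int c c] blockop_form[OF FKG_int a a] .
qed

end

end

section \<open>Summation over the degrees\<close>

lemma hermitian_psd_spectral_density:
  assumes F: "spectral_density T F" and x: "x \<in> {-pi..pi}"
  shows "hermitian_psd T (F x)"
  unfolding hermitian_psd_def
proof (intro conjI ballI)
  show "F x \<in> carrier_mat T T" "\<forall>p<T. \<forall>q<T. F x $$ (p,q) = cnj (F x $$ (q,p))"
    using F x unfolding spectral_density_def by blast+
  fix v :: "complex vec" assume "v \<in> carrier_vec T"
  \<comment> \<open>\<open>spectral_density\<close> tests the form at conjugated vectors.
    Conjugation is an involution, so all vectors are covered.\<close>
  then have "0 \<le> Re (qform (cvec (cvec v)) (F x) (cvec (cvec v)))"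
    using F x unfolding spectral_density_def by blast
  then show "0 \<le> Re (qform v (F x) v)" by simp
qed

lemma AE_spectral_density:
  assumes "spectral_density T F"
  shows "AE x in lpi. hermitian_psd T (F x)"
  using AE_lpi_interval by eventually_elim (rule hermitian_psd_spectral_density[OF assms])

lemma spectral_density_psd_triple:
  assumes F: "spectral_density T (F m)" and G: "spectral_density T (G m)"
    and inv: "mat_inverse (Hmat F G m x) \<noteq> None" and x: "x \<in> {-pi..pi}"
  shows "psd_triple T (F m x) (G m x) (Hinv F G m x)"
proof -
  note psd = hermitian_psd_spectral_density[OF F x] hermitian_psd_spectral_density[OF G x]
  note H = hermitian_psd_add[OF psd]
  note Hc = hermitian_psd_carrier[OF H]
  note inv = minv_inverse[OF Hc inv[unfolded Hmat_def]]
  note K = hermitian_psd_inverse[OF H minv_carrier[OF Hc] inv]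
  show ?thesis
    unfolding Hinv_def Hmat_def by unfold_locales (fact psd K inv)+
qed

lemma spectral_density_integrable: "spectral_density T F \<Longrightarrow> mat_integrable T F"
  by (simp add: spectral_density_def mat_integrable_def intblepi_iff)

lemma spectral_pair_Mset:
  assumes F: "spectral_density T (F m)" and G: "spectral_density T (G m)" and m: "m \<in> Mset F G"
  shows "spectral_pair T (F m) (G m) (Hinv F G m)"
proof
  note Fi = spectral_density_integrable[OF F] and Gi = spectral_density_integrable[OF G]
  show "mat_integrable T (F m)" "mat_integrable T (G m)" by fact+
  note Hm = mat_measurable_add[OF Fi[THEN mat_integrable_imp_measurable] Gi[THEN mat_integrable_imp_measurable]]
  have K: "Hinv F G m x = minv (F m x + G m x)" for x
    by (simp add: Hinv_def Hmat_def)
  show Km: "mat_measurable T (Hinv F G m)"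
    using minv_measurable[OF Hm] unfolding K[abs_def] .
  have "AE x in lborel. x \<in> {-pi..pi} \<longrightarrow> mat_inverse (Hmat F G m x) \<noteq> None"
    using m by (simp add: Mset_def)
  from AE_lpiI[OF this] AE_lpi_interval
  show "AE x in lpi. psd_triple T (F m x) (G m x) (Hinv F G m x)"
    by eventually_elim (rule spectral_density_psd_triple[of T F m G, OF F G])
  have "integrable lpi (\<lambda>x. mtrace (Hinv F G m x))"
    using m by (simp add: Mset_def intblepi_iff)
  moreover have "dim_row (Hinv F G m x) = T" for x
    using mat_measurable_carrier[OF Km, of x] by simp
  ultimately show "integrable lpi (\<lambda>x. \<Sum>p<T. Hinv F G m x $$ (p,p))"
    by (simp add: mtrace_def)
qed

lemma aflat_carrier: "aflat T N a m l \<in> carrier_vec ((N+1) * T)"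
  by (simp add: aflat_def)

lemma AN_eq_tvec: "AN T N a m l x = tvec T N (aflat T N a m l) x"
proof (rule eq_vecI)
  fix p assume "p < dim_vec (tvec T N (aflat T N a m l) x)"
  then have p: "p < T" by (simp add: tvec_def)
  have "aflat T N a m l $ (j * T + p) = a m l j * exp (2 * pi * \<i> * of_nat p * of_nat j / of_nat T)"
    if "j \<le> N" for j
    using p block_less[OF that p] by (simp add: aflat_def)
  then show "AN T N a m l x $ p = tvec T N (aflat T N a m l) x $ p"
    using p by (simp add: AN_def tvec_def)
qed (simp add: AN_def tvec_def)

lemma CN_eq_tvec: "CN T N F G a m l x = tvec T N (cflat T N F G a m l) x"
  by (simp add: CN_def tvec_def)

theorem theorem1:
  fixes T N n :: nat
    and F G :: "nat \<Rightarrow> real \<Rightarrow> complex mat"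
    and a :: "nat \<Rightarrow> nat \<Rightarrow> nat \<Rightarrow> complex"
  assumes T_pos: "T \<ge> 1"
    and n_ge: "n \<ge> 2"
    and F_sd: "\<forall>m. spectral_density T (F m)"
    and G_sd: "\<forall>m. spectral_density T (G m)"
    and zeta_moments: "\<forall>j. summable (\<lambda>m. real (hdim m n) * Re (intpi (\<lambda>x. qform (evec T j) (F m x) (evec T j))))"
    and theta_moments: "\<forall>j. summable (\<lambda>m. real (hdim m n) * Re (intpi (\<lambda>x. qform (evec T j) (G m x) (evec T j))))"
    and functional: "summable (\<lambda>m. \<Sum>l\<in>{1..hdim m n}. Re (intpi (\<lambda>x. qform (AN T N a m l x) (F m x) (AN T N a m l x))))"
    and minimality: "Mset F G \<noteq> {}"
  shows
    "let h0 = (\<lambda>m l x. mult_mat_vec (transpose_mat (Hinv F G m x)) (rF T N F G a m l x)) in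
       h0 \<in> L2N T N n F G \<and>
       (\<forall>h\<in>L2N T N n F G. Delta T N n a h0 F G \<le> Delta T N n a h F G) \<and>
       (\<forall>m\<in>Mset F G. \<forall>l\<in>{1..hdim m n}. AE x in lborel. x \<in> {-pi..pi} \<longrightarrow>
          h0 m l x = AN T N a m l x - mult_mat_vec (transpose_mat (Hinv F G m x)) (rG T N F G a m l x)) \<and>
       complex_of_real (Delta T N n a h0 F G) =
         (\<Sum>m. if m \<in> Mset F G then
            (\<Sum>l\<in>{1..hdim m n}. 1 / (2 * pi) * intpi (\<lambda>x.
                qform (rG T N F G a m l x) (Hinv F G m x * F m x * Hinv F G m x) (rG T N F G a m l x)
              + qform (rF T N F G a m l x) (Hinv F G m x * G m x * Hinv F G m x) (rF T N F G a m l x)))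
          else 0) \<and>
       complex_of_real (Delta T N n a h0 F G) =
         (\<Sum>m. if m \<in> Mset F G then
            (\<Sum>l\<in>{1..hdim m n}.
                scalar_prod (cvec (cflat T N F G a m l)) (mult_mat_vec (Bop T N F G m) (cflat T N F G a m l))
              + scalar_prod (cvec (aflat T N a m l)) (mult_mat_vec (Rop T N F G m) (aflat T N a m l)))
          else 0)"
proof -
  let ?M = "Mset F G"
  define h0 where "h0 = (\<lambda>m l x. (Hinv F G m x)\<^sup>T *\<^sub>v rF T N F G a m l x)"
  \<comment> \<open>For each degree, \<open>S\<close> is the squared F-norm of \<open>A\<close>,
    \<open>Q h\<close> the squared H-norm of \<open>h\<close>, and \<open>E h\<close> the
    contribution to \<open>Delta\<close>. All convergence rests on \<open>Q h0\<close> \<le>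
    \<open>S\<close> and \<open>E h\<close> \<le> \<open>(S + Q h) / pi\<close>.\<close>
  define S where "S m = (\<Sum>l\<in>{1..hdim m n}. Re (intpi (\<lambda>x. qform (AN T N a m l x) (F m x) (AN T N a m l x))))" for m
  define Q where "Q h m = (if m \<in> ?M then
      (\<Sum>l\<in>{1..hdim m n}. Re (intpi (\<lambda>x. qform (h m l x) (Hmat F G m x) (h m l x)))) else 0)"
    for h :: "nat \<Rightarrow> nat \<Rightarrow> real \<Rightarrow> complex vec" and m
  define E where "E h m = (if m \<in> ?M then
      (\<Sum>l\<in>{1..hdim m n}. spectral_pair.mse (F m) (G m) (AN T N a m l) (h m l)) else 0)" for h m
  define adm where "adm m h = spectral_pair.admissible T (F m) (G m) N h" for m h
  have sp: "spectral_pair T (F m) (G m) (Hinv F G m)" if "m \<in> ?M" for m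
    using F_sd G_sd that by (intro spectral_pair_Mset) auto
  have ac: "aflat T N a m l \<in> carrier_vec ((N+1) * T)" for m l by (rule aflat_carrier)
  have AN: "AN T N a m l = tvec T N (aflat T N a m l)" for m l
    by (rule ext) (rule AN_eq_tvec)
  have cf: "cflat T N F G a m l = spectral_pair.opt_coeffs T (F m) (Hinv F G m) N (aflat T N a m l)" if "m \<in> ?M" for m l
    unfolding cflat_def spectral_pair.opt_coeffs_def[OF sp[OF that] ac] Bop_def Dop_def ..
  have CN: "CN T N F G a m l x = tvec T N (spectral_pair.opt_coeffs T (F m) (Hinv F G m) N (aflat T N a m l)) x"
    if "m \<in> ?M" for m l x
    unfolding CN_eq_tvec cf[OF that] ..
  have rF: "rF T N F G a m l x = (F m x)\<^sup>T *\<^sub>v tvec T N (aflat T N a m l) x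
      - tvec T N (spectral_pair.opt_coeffs T (F m) (Hinv F G m) N (aflat T N a m l)) x" if "m \<in> ?M" for m l x
    unfolding rF_def AN CN[OF that] ..
  have rG: "rG T N F G a m l x = (G m x)\<^sup>T *\<^sub>v tvec T N (aflat T N a m l) x
      + tvec T N (spectral_pair.opt_coeffs T (F m) (Hinv F G m) N (aflat T N a m l)) x" if "m \<in> ?M" for m l x
    unfolding rG_def AN CN[OF that] ..
  have opt: "h0 m l = spectral_pair.opt T (F m) (Hinv F G m) N (aflat T N a m l)" if "m \<in> ?M" for m l
    by (rule ext) (simp only: h0_def spectral_pair.opt_def[OF sp[OF that] ac] rF[OF that])
  have Delta: "Delta T N n a h F G = (\<Sum>m. E h m)" for h
    unfolding Delta_def E_def
    by (intro arg_cong[of _ _ suminf] ext if_cong sum.cong refl)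
       (simp only: spectral_pair.mse_def[OF sp] intpi_eq)
  have L2N: "h \<in> L2N T N n F G \<longleftrightarrow> (\<forall>m\<in>?M. \<forall>l\<in>{1..hdim m n}. adm m (h m l)) \<and> summable (Q h)" for h
  proof -
    have "adm m (h m l) \<longleftrightarrow> (\<forall>x. h m l x \<in> carrier_vec T) \<and>
        (\<forall>p<T. intblepi (\<lambda>x. h m l x $ p)) \<and>
        (\<forall>j\<le>N. \<forall>p<T. intpi (\<lambda>x. h m l x $ p * exp (- \<i> * of_nat j * x)) = 0) \<and>
        intblepi (\<lambda>x. qform (h m l x) (Hmat F G m x) (h m l x))" if "m \<in> ?M" for m l
      unfolding adm_def spectral_pair.admissible_def[OF sp[OF that]] cnj_emode intpi_eq intblepi_iff Hmat_def ..
    then show ?thesis unfolding L2N_def Q_def[abs_def] by simp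
  qed
  have psdF: "AE x in lpi. hermitian_psd T (F m x)" for m
    using F_sd by (intro AE_spectral_density) simp
  have A_nonneg: "0 \<le> Re (intpi (\<lambda>x. qform (AN T N a m l x) (F m x) (AN T N a m l x)))" for m l
    unfolding intpi_eq AN
    by (rule Re_integral_qform_nonneg[of T "F m" "tvec T N (aflat T N a m l)", OF psdF tvec_carrier])
  have S: "summable S" using functional unfolding S_def .
  have S_nonneg: "0 \<le> S m" for m unfolding S_def by (intro sum_nonneg A_nonneg)
  have E_nonneg: "0 \<le> E h m" if "\<forall>m\<in>?M. \<forall>l\<in>{1..hdim m n}. adm m (h m l)" for h m
    using that unfolding E_def adm_def AN
    by (auto intro!: sum_nonneg spectral_pair.mse_nonneg[OF sp ac])
  have E_summable: "summable (E h)" if h: "h \<in> L2N T N n F G" for h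
  proof (rule summable_comparison_test')
    have Q: "summable (Q h)" and ad: "\<forall>m\<in>?M. \<forall>l\<in>{1..hdim m n}. adm m (h m l)"
      using h unfolding L2N by auto
    show "summable (\<lambda>m. (S m + Q h m) / pi)"
      by (intro summable_divide summable_add S Q)
    fix m
    have "E h m \<le> (S m + Q h m) / pi"
    proof (cases "m \<in> ?M")
      case True
      have "E h m \<le> (\<Sum>l\<in>{1..hdim m n}. (Re (intpi (\<lambda>x. qform (AN T N a m l x) (F m x) (AN T N a m l x)))
          + Re (intpi (\<lambda>x. qform (h m l x) (Hmat F G m x) (h m l x)))) / pi)"
        using True ad unfolding E_def adm_def AN intpi_eq Hmat_def
        by (auto intro!: sum_mono spectral_pair.mse_le[OF sp ac])
      also have "\<dots> = (S m + Q h m) / pi"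
        using True by (simp add: S_def Q_def sum.distrib flip: sum_divide_distrib)
      finally show ?thesis .
    \<comment> \<open>Outside \<open>?M\<close> both \<open>E\<close> and \<open>Q\<close> are 0,
      while \<open>S\<close> counts every degree.\<close>
    qed (use S_nonneg[of m] in \<open>simp add: E_def Q_def\<close>)
    then show "norm (E h m) \<le> (S m + Q h m) / pi"
      using E_nonneg[OF ad, of m] by simp
  qed
  have h0_adm: "\<forall>m\<in>?M. \<forall>l\<in>{1..hdim m n}. adm m (h0 m l)"
    unfolding adm_def by (auto simp: opt intro: spectral_pair.opt_admissible[OF sp ac])
  have Q_h0: "0 \<le> Q h0 m" "Q h0 m \<le> S m" for m
  proof -
    show "0 \<le> Q h0 m"
      unfolding Q_def intpi_eq Hmat_def
      by (auto intro!: sum_nonneg Re_integral_qform_nonneg[of T "\<lambda>x. F m x + G m x"]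
          spectral_pair.AE_psd(3)[OF sp] simp: opt spectral_pair.opt_carrier[OF sp ac])
    show "Q h0 m \<le> S m"
    proof (cases "m \<in> ?M")
      case True
      then show ?thesis
        unfolding Q_def S_def intpi_eq Hmat_def AN
        by (auto intro!: sum_mono spectral_pair.opt_norm_le[OF sp ac] simp: opt)
    qed (use S_nonneg[of m] in \<open>simp add: Q_def\<close>)
  qed
  have "summable (Q h0)"
    by (rule summable_comparison_test'[OF S]) (use Q_h0 in simp)
  with h0_adm have h0_L2N: "h0 \<in> L2N T N n F G" unfolding L2N by simp
  have optimal: "Delta T N n a h0 F G \<le> Delta T N n a h F G" if h: "h \<in> L2N T N n F G" for h
    unfolding Delta
  proof (rule suminf_le[OF _ E_summable[OF h0_L2N] E_summable[OF h]])
    fix m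
    have "adm m (h m l)" if "m \<in> ?M" "l \<in> {1..hdim m n}" for l
      using h that unfolding L2N by blast
    then show "E h0 m \<le> E h m"
      unfolding E_def AN adm_def
      by (auto intro!: sum_mono spectral_pair.mse_opt_le[OF sp ac] simp: opt)
  qed
  \<comment> \<open>Only almost everywhere: where the summed density is singular,
    \<open>Hinv\<close> is the zero matrix by default, so \<open>h0\<close> is 0 whereas the right
    side is \<open>AN\<close>.\<close>
  have complement: "AE x in lborel. x \<in> {-pi..pi} \<longrightarrow>
      h0 m l x = AN T N a m l x - (Hinv F G m x)\<^sup>T *\<^sub>v rG T N F G a m l x" if m: "m \<in> ?M" for m l
  proof -
    have "AE x in lborel. x \<in> {-pi..pi} \<longrightarrow> mat_inverse (Hmat F G m x) \<noteq> None"
      using m by (simp add: Mset_def)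
    then show ?thesis
    proof (rule eventually_mono, intro impI)
      fix x assume *: "x \<in> {-pi..pi} \<longrightarrow> mat_inverse (Hmat F G m x) \<noteq> None" and x: "x \<in> {-pi..pi}"
      interpret psd_triple T "F m x" "G m x" "Hinv F G m x"
        by (rule spectral_density_psd_triple[of T F m G x]) (use F_sd G_sd * x in auto)
      show "h0 m l x = AN T N a m l x - (Hinv F G m x)\<^sup>T *\<^sub>v rG T N F G a m l x"
        unfolding h0_def rF[OF m] rG[OF m] AN by (rule optimal_complement[OF tvec_carrier tvec_carrier])
    qed
  qed
  \<comment> \<open>The embedding into the complex numbers passes through the series because the
    errors of \<open>h0\<close> are summable; the two formulas can then be matched degree by
    degree.\<close>
  have of_real_Delta: "complex_of_real (Delta T N n a h0 F G) = (\<Sum>m. complex_of_real (E h0 m))"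
    unfolding Delta by (rule suminf_of_real[OF E_summable[OF h0_L2N]])
  have E1: "complex_of_real (E h0 m) = (if m \<in> ?M then
            (\<Sum>l\<in>{1..hdim m n}. 1 / (2 * pi) * intpi (\<lambda>x.
                qform (rG T N F G a m l x) (Hinv F G m x * F m x * Hinv F G m x) (rG T N F G a m l x)
              + qform (rF T N F G a m l x) (Hinv F G m x * G m x * Hinv F G m x) (rF T N F G a m l x)))
          else 0)" for m
  proof (cases "m \<in> ?M")
    case True
    then show ?thesis
      by (simp only: E_def AN opt intpi_eq rF rG of_real_sum if_True spectral_pair.mse_opt_spectral[OF sp ac])
  qed (simp add: E_def)
  have E2: "complex_of_real (E h0 m) = (if m \<in> ?M then
            (\<Sum>l\<in>{1..hdim m n}.
                scalar_prod (cvec (cflat T N F G a m l)) (mult_mat_vec (Bop T N F G m) (cflat T N F G a m l))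
              + scalar_prod (cvec (aflat T N a m l)) (mult_mat_vec (Rop T N F G m) (aflat T N a m l)))
          else 0)" for m
  proof (cases "m \<in> ?M")
    case True
    then show ?thesis
      by (simp only: E_def AN opt Bop_def Rop_def cf of_real_sum if_True spectral_pair.mse_opt_operator[OF sp ac])
  qed (simp add: E_def)
  show ?thesis
    unfolding Let_def h0_def[symmetric]
  proof (intro conjI ballI)
    show "complex_of_real (Delta T N n a h0 F G) =
         (\<Sum>m. if m \<in> Mset F G then
            (\<Sum>l\<in>{1..hdim m n}. 1 / (2 * pi) * intpi (\<lambda>x.
                qform (rG T N F G a m l x) (Hinv F G m x * F m x * Hinv F G m x) (rG T N F G a m l x)
              + qform (rF T N F G a m l x) (Hinv F G m x * G m x * Hinv F G m x) (rF T N F G a m l x)))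
          else 0)"
      unfolding of_real_Delta E1 ..
    show "complex_of_real (Delta T N n a h0 F G) =
         (\<Sum>m. if m \<in> Mset F G then
            (\<Sum>l\<in>{1..hdim m n}.
                scalar_prod (cvec (cflat T N F G a m l)) (mult_mat_vec (Bop T N F G m) (cflat T N F G a m l))
              + scalar_prod (cvec (aflat T N a m l)) (mult_mat_vec (Rop T N F G m) (aflat T N a m l)))
          else 0)"
      unfolding of_real_Delta E2 ..
  qed (use h0_L2N optimal complement in blast)+
qed

end
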